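(* Let $k$ be an algebraically closed field of characteristic zero, $G$ a group, $a\in Z(G)$, $\chi\in\hat G$ with $\chi(a)\neq 1$, and $H=kG(\chi^{-1},a,0)$. Assume that $|\chi|=\infty$ and that $q:=\chi^{-1}(a)$ is not a root of unity. Then for any $\lambda,\sigma\in\hat G$ and any integers $s,t\geq 1$, there is an isomorphism of $H$-modules $$V_s(\lambda)\otimes V_t(\sigma)\cong\bigoplus_{i=1}^{\min\{s,t\}}V_{s+t+1-2i}(\chi^{i-1}\lambda\sigma).$$
   Context: $Z(G)$ is the center of $G$; $\hat G$ is the group (under pointwise product) of characters, i.e. group homomorphisms $G\to k^\times=k\setminus\{0\}$; $|\chi|$ is the order of $\chi$ in $\hat G$. The Hopf algebra $H=kG(\chi^{-1},a,0)$ is generated as a $k$-algebra by the group algebra $kG$ and an element $x$ subject to $xg=\chi^{-1}(g)gx$ for $g\in G$; it has $k$-basis $\{gx^i\mid g\in G,\ i\geq 0\}$. Its coalgebra structure and antipode are given by $\Delta(x)=x\otimes a+1\otimes x$, $\varepsilon(x)=0$, $S(x)=-xa^{-1}$, $\Delta(g)=g\otimes g$, $\varepsilon(g)=1$, $S(g)=g^{-1}$ for $g\in G$. Modules are left modules, $\otimes=\otimes_k$, and $H$ acts on a tensor product of modules via $\Delta$. For $\lambda\in\hat G$ and an integer $t\geq 1$, $V_t(\lambda)$ is the $t$-dimensional $H$-module with $k$-basis $m_0,\dots,m_{t-1}$ and action $g\cdot m_i=\chi^i(g)\lambda(g)m_i$ for $g\in G$, $0\le i\le t-1$; $x\cdot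 m_i=m_{i+1}$ for $0\leq i\leq t-2$; $x\cdot m_{t-1}=0$. *)

theory Defs
  imports "HOL-Algebra.Algebra" "HOL-Algebra.Algebraic_Closure_Type"
   "HOL-Computational_Algebra.Polynomial"
    "HOL-Library.Poly_Mapping"
begin

text \<open>The ground field is a type \<open>'k\<close> of class \<^class>\<open>field\<close>; groups, algebras and modules are
  records with carriers, as in HOL-Algebra.  The vector space with basis \<open>B\<close> is the set of
  finitely supported functions with support in \<open>B\<close>; the basis vector \<open>b\<close> is
  \<open>Poly_Mapping.single b 1\<close>.\<close>

definition fscale :: "'k::field \<Rightarrow> ('b \<Rightarrow>\<^sub>0 'k) \<Rightarrow> ('b \<Rightarrow>\<^sub>0 'k)"
  where "fscale c p = Poly_Mapping.map ((*) c) p"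

abbreviation bvec :: "'b \<Rightarrow> ('b \<Rightarrow>\<^sub>0 'k::field)"
  where "bvec b \<equiv> Poly_Mapping.single b 1"

definition fspace :: "'b set \<Rightarrow> ('b \<Rightarrow>\<^sub>0 'k::field) set"
  where "fspace B = {p. Poly_Mapping.keys p \<subseteq> B}"

lemma lookup_fscale [simp]: "Poly_Mapping.lookup (fscale c p) b = c * Poly_Mapping.lookup p b"
  unfolding fscale_def by (transfer fixing: c) (auto simp: when_def)

lemma vector_space_fscale: "vector_space (fscale :: 'k::field \<Rightarrow> ('b \<Rightarrow>\<^sub>0 'k) \<Rightarrow> _)"
  by unfold_locales (auto intro!: poly_mapping_eqI simp: lookup_add algebra_simps)


section \<open>Characters\<close>

definition center :: "('g, 'm) monoid_scheme \<Rightarrow> 'g set"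
  where "center G = {z \<in> carrier G. \<forall>g\<in>carrier G. z \<otimes>\<^bsub>G\<^esub> g = g \<otimes>\<^bsub>G\<^esub> z}"

text \<open>Characters are extensional functions, so that equality in the character group means
  agreement on \<open>carrier G\<close>.\<close>

definition char_group :: "('g, 'm) monoid_scheme \<Rightarrow> ('g \<Rightarrow> 'k::field) monoid"
  where "char_group G =
    \<lparr>carrier = hom G (mult_of ring_of_type_algebra) \<inter> extensional (carrier G),
     monoid.mult = (\<lambda>\<phi> \<psi>. \<lambda>g\<in>carrier G. \<phi> g * \<psi> g),
     one = (\<lambda>g\<in>carrier G. 1)\<rparr>"


lemma character_simps:
  assumes "group G" "\<psi> \<in> carrier (char_group G)" "g \<in> carrier G" "h \<in> carrier G"
  shows "\<psi> (g \<otimes>\<^bsub>G\<^esub> h) = \<psi> g * (\<psi> h :: 'k::field)" "\<psi> g \<noteq> 0" "\<psi> \<one>\<^bsub>G\<^esub> = 1"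
proof -
  have 1: "\<psi> (g \<otimes>\<^bsub>G\<^esub> h) = \<psi> g * \<psi> h" if "g \<in> carrier G" "h \<in> carrier G" for g h
    using assms that by (auto simp: char_group_def hom_def ring_of_type_algebra_def Ring_Divisibility.mult_of_def)
  have 2: "\<psi> g \<noteq> 0" if "g \<in> carrier G" for g
    using assms that by (auto simp: char_group_def hom_def ring_of_type_algebra_def Ring_Divisibility.mult_of_def Pi_def)
  show "\<psi> (g \<otimes>\<^bsub>G\<^esub> h) = \<psi> g * \<psi> h" "\<psi> g \<noteq> 0" using 1 2 assms by auto
  have "\<one>\<^bsub>G\<^esub> \<in> carrier G" using assms(1) by (simp add: group.is_monoid)
  then show "\<psi> \<one>\<^bsub>G\<^esub> = 1" using 1[of "\<one>\<^bsub>G\<^esub>" "\<one>\<^bsub>G\<^esub>"] 2[of "\<one>\<^bsub>G\<^esub>"] assms(1) by (simp add: group.is_monoid)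
qed

lemma comm_group_char_group:
  assumes "group G"
  shows "comm_group (char_group G :: ('g \<Rightarrow> 'k::field) monoid)"
proof -
  interpret group G by fact
  show ?thesis
  proof (rule comm_groupI)
    fix x :: "'g \<Rightarrow> 'k" assume x: "x \<in> carrier (char_group G)"
    note h = character_simps[OF assms x]
    have "(\<lambda>g\<in>carrier G. inverse (x g)) \<in> carrier (char_group G)"
      using h by (auto simp: char_group_def hom_def ring_of_type_algebra_def Ring_Divisibility.mult_of_def)
    moreover have "(\<lambda>g\<in>carrier G. inverse (x g)) \<otimes>\<^bsub>char_group G\<^esub> x = \<one>\<^bsub>char_group G\<^esub>"
      using h by (auto simp: char_group_def fun_eq_iff restrict_def)
    ultimately show "\<exists>y\<in>carrier (char_group G). y \<otimes>\<^bsub>char_group G\<^esub> x = \<one>\<^bsub>char_group G\<^esub>" by blast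
  next
    fix x y :: "'g \<Rightarrow> 'k" assume x: "x \<in> carrier (char_group G)" "y \<in> carrier (char_group G)"
    show "x \<otimes>\<^bsub>char_group G\<^esub> y \<in> carrier (char_group G)"
    using x by (auto simp: char_group_def hom_def ring_of_type_algebra_def Ring_Divisibility.mult_of_def Pi_def algebra_simps)
  qed (auto simp: char_group_def hom_def ring_of_type_algebra_def Ring_Divisibility.mult_of_def fun_eq_iff restrict_def extensional_def algebra_simps)
qed


section \<open>Left modules over a ring that need not be commutative\<close>

locale left_module = R?: ring R + M?: abelian_group M
  for R :: "('h, 'm) ring_scheme" (structure) and M :: "('h, 'v, 'n) module_scheme" (structure) +
  assumes smult_closed:
      "a \<in> carrier R \<Longrightarrow> v \<in> carrier M \<Longrightarrow> a \<odot>\<^bsub>M\<^esub> v \<in> carrier M"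
    and smult_l_distr:
      "a \<in> carrier R \<Longrightarrow> b \<in> carrier R \<Longrightarrow> v \<in> carrier M \<Longrightarrow>
        (a \<oplus>\<^bsub>R\<^esub> b) \<odot>\<^bsub>M\<^esub> v = a \<odot>\<^bsub>M\<^esub> v \<oplus>\<^bsub>M\<^esub> b \<odot>\<^bsub>M\<^esub> v"
    and smult_r_distr:
      "a \<in> carrier R \<Longrightarrow> v \<in> carrier M \<Longrightarrow> w \<in> carrier M \<Longrightarrow>
        a \<odot>\<^bsub>M\<^esub> (v \<oplus>\<^bsub>M\<^esub> w) = a \<odot>\<^bsub>M\<^esub> v \<oplus>\<^bsub>M\<^esub> a \<odot>\<^bsub>M\<^esub> w"
    and smult_assoc:
      "a \<in> carrier R \<Longrightarrow> b \<in> carrier R \<Longrightarrow> v \<in> carrier M \<Longrightarrow>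
        (a \<otimes>\<^bsub>R\<^esub> b) \<odot>\<^bsub>M\<^esub> v = a \<odot>\<^bsub>M\<^esub> (b \<odot>\<^bsub>M\<^esub> v)"
    and smult_one: "v \<in> carrier M \<Longrightarrow> \<one>\<^bsub>R\<^esub> \<odot>\<^bsub>M\<^esub> v = v"

definition left_module_hom ::
  "('h, 'm) ring_scheme \<Rightarrow> ('h, 'v, 'n) module_scheme \<Rightarrow> ('h, 'w, 'p) module_scheme \<Rightarrow> ('v \<Rightarrow> 'w) set"
  where "left_module_hom R M N =
    {f \<in> carrier M \<rightarrow> carrier N.
      (\<forall>v\<in>carrier M. \<forall>w\<in>carrier M. f (v \<oplus>\<^bsub>M\<^esub> w) = f v \<oplus>\<^bsub>N\<^esub> f w) \<and>
      (\<forall>a\<in>carrier R. \<forall>v\<in>carrier M. f (a \<odot>\<^bsub>M\<^esub> v) = a \<odot>\<^bsub>N\<^esub> f v)}"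

definition left_module_isomorphic ::
  "('h, 'm) ring_scheme \<Rightarrow> ('h, 'v, 'n) module_scheme \<Rightarrow> ('h, 'w, 'p) module_scheme \<Rightarrow> bool"
  where "left_module_isomorphic R M N \<longleftrightarrow>
    left_module R M \<and> left_module R N \<and>
    (\<exists>f\<in>left_module_hom R M N. bij_betw f (carrier M) (carrier N))"

text \<open>In the module records below the ring multiplication and unit are irrelevant and are left
  undefined.\<close>

definition direct_sum :: "'i set \<Rightarrow> ('i \<Rightarrow> ('h, 'v, 'm) module_scheme) \<Rightarrow> ('h, 'i \<Rightarrow> 'v) module"
  where "direct_sum I M =
    \<lparr>carrier = {f \<in> (\<Pi>\<^sub>E i\<in>I. carrier (M i)). finite {i \<in> I. f i \<noteq> \<zero>\<^bsub>M i\<^esub>}},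
     monoid.mult = undefined, one = undefined,
     ring.zero = (\<lambda>i\<in>I. \<zero>\<^bsub>M i\<^esub>),
     add = (\<lambda>f f'. \<lambda>i\<in>I. f i \<oplus>\<^bsub>M i\<^esub> f' i),
     module.smult = (\<lambda>a f. \<lambda>i\<in>I. a \<odot>\<^bsub>M i\<^esub> f i)\<rparr>"


section \<open>Tensor products over the ground field\<close>

text \<open>\<open>V \<otimes> W\<close> is the free vector space on \<open>V \<times> W\<close> modulo the span of the bilinearity relations;
  its elements are cosets.\<close>

definition tensor_relations ::
  "('k::field, 'v, 'm) module_scheme \<Rightarrow> ('k, 'w, 'n) module_scheme \<Rightarrow> ('v \<times> 'w \<Rightarrow>\<^sub>0 'k) set"
  where "tensor_relations V W =
    {bvec (v \<oplus>\<^bsub>V\<^esub> v', w) - bvec (v, w) - bvec (v', w) |v v' w.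
        v \<in> carrier V \<and> v' \<in> carrier V \<and> w \<in> carrier W} \<union>
    {bvec (v, w \<oplus>\<^bsub>W\<^esub> w') - bvec (v, w) - bvec (v, w') |v w w'.
        v \<in> carrier V \<and> w \<in> carrier W \<and> w' \<in> carrier W} \<union>
    {bvec (c \<odot>\<^bsub>V\<^esub> v, w) - fscale c (bvec (v, w)) |c v w. v \<in> carrier V \<and> w \<in> carrier W} \<union>
    {bvec (v, c \<odot>\<^bsub>W\<^esub> w) - fscale c (bvec (v, w)) |c v w. v \<in> carrier V \<and> w \<in> carrier W}"

definition tensor_class ::
  "('k::field, 'v, 'm) module_scheme \<Rightarrow> ('k, 'w, 'n) module_scheme \<Rightarrow>
    ('v \<times> 'w \<Rightarrow>\<^sub>0 'k) \<Rightarrow> ('v \<times> 'w \<Rightarrow>\<^sub>0 'k) set"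
  where "tensor_class V W p = (\<lambda>r. p + r) ` Modules.module.span fscale (tensor_relations V W)"

definition pure_tensor ::
  "('k::field, 'v, 'm) module_scheme \<Rightarrow> ('k, 'w, 'n) module_scheme \<Rightarrow>
    'v \<Rightarrow> 'w \<Rightarrow> ('v \<times> 'w \<Rightarrow>\<^sub>0 'k) set"
  where "pure_tensor V W v w = tensor_class V W (bvec (v, w))"

text \<open>The bilinear extension of \<open>(u, u') \<cdot> (v, v') = (f u v, f' u' v')\<close> to formal sums.\<close>

definition formal_product ::
  "('u \<Rightarrow> 'v \<Rightarrow> 'w) \<Rightarrow> ('u' \<Rightarrow> 'v' \<Rightarrow> 'w') \<Rightarrow>
    ('u \<times> 'u' \<Rightarrow>\<^sub>0 'k::field) \<Rightarrow> ('v \<times> 'v' \<Rightarrow>\<^sub>0 'k) \<Rightarrow> ('w \<times> 'w' \<Rightarrow>\<^sub>0 'k)"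
  where "formal_product f f' p q =
    (\<Sum>u\<in>Poly_Mapping.keys p. \<Sum>v\<in>Poly_Mapping.keys q.
      Poly_Mapping.single (f (fst u) (fst v), f' (snd u) (snd v))
        (Poly_Mapping.lookup p u * Poly_Mapping.lookup q v))"

text \<open>Operations on cosets are unions over all representatives, as in HOL-Algebra's quotient
  rings.  For algebras \<open>V\<close>, \<open>W\<close> the fields \<open>mult\<close> and \<open>one\<close> give the tensor product algebra; for
  mere vector spaces they are irrelevant.\<close>

definition tensor ::
  "('k::field, 'v, 'm) module_scheme \<Rightarrow> ('k, 'w, 'n) module_scheme \<Rightarrow>
    ('k, ('v \<times> 'w \<Rightarrow>\<^sub>0 'k) set) module"
  where "tensor V W =
    \<lparr>carrier = tensor_class V W ` fspace (carrier V \<times> carrier W),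
     monoid.mult = (\<lambda>P Q. \<Union>p\<in>P. \<Union>q\<in>Q.
       tensor_class V W (formal_product (\<lambda>v v'. v \<otimes>\<^bsub>V\<^esub> v') (\<lambda>w w'. w \<otimes>\<^bsub>W\<^esub> w') p q)),
     one = pure_tensor V W \<one>\<^bsub>V\<^esub> \<one>\<^bsub>W\<^esub>,
     ring.zero = tensor_class V W 0,
     add = (\<lambda>P Q. \<Union>p\<in>P. \<Union>q\<in>Q. tensor_class V W (p + q)),
     module.smult = (\<lambda>c P. \<Union>p\<in>P. tensor_class V W (fscale c p))\<rparr>"


section \<open>Tensor products of modules over a Hopf algebra\<close>

record (overloaded) ('k::zero, 'h) hopf_algebra = "('k, 'h) module" +
  comult :: "'h \<Rightarrow> ('h \<times> 'h \<Rightarrow>\<^sub>0 'k) set"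
  counit :: "'h \<Rightarrow> 'k"
  antipode :: "'h \<Rightarrow> 'h"

text \<open>The underlying vector space of a module over an algebra \<open>A\<close>: scalars act through
  \<open>c \<mapsto> c \<cdot> 1\<close>.\<close>

definition restrict_scalars ::
  "('k, 'h, 'm) module_scheme \<Rightarrow> ('h, 'v, 'n) module_scheme \<Rightarrow> ('k, 'v) module"
  where "restrict_scalars A M =
    \<lparr>carrier = carrier M, monoid.mult = undefined, one = undefined,
     ring.zero = \<zero>\<^bsub>M\<^esub>, add = add M,
     module.smult = (\<lambda>c v. (c \<odot>\<^bsub>A\<^esub> \<one>\<^bsub>A\<^esub>) \<odot>\<^bsub>M\<^esub> v)\<rparr>"

definition tensor_module ::
  "('k::field, 'h, 'm) hopf_algebra_scheme \<Rightarrow>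
    ('h, 'v, 'n) module_scheme \<Rightarrow> ('h, 'w, 'p) module_scheme \<Rightarrow>
    ('h, ('v \<times> 'w \<Rightarrow>\<^sub>0 'k) set) module"
  where "tensor_module H M N =
    (let V = restrict_scalars H M; W = restrict_scalars H N in
    \<lparr>carrier = carrier (tensor V W), monoid.mult = undefined, one = undefined,
     ring.zero = ring.zero (tensor V W), add = add (tensor V W),
     module.smult = (\<lambda>h P. \<Union>d\<in>comult H h. \<Union>p\<in>P.
       tensor_class V W (formal_product (module.smult M) (module.smult N) d p))\<rparr>)"


section \<open>The Hopf algebra \<open>kG(\<psi>, a, 0)\<close> and its modules \<open>V\<^sub>t(\<rho>)\<close>\<close>

text \<open>The basis vector \<open>(g, i)\<close> stands for \<open>g x\<^sup>i\<close>.  Moving \<open>x\<^sup>i\<close> past \<open>h\<close> with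
  \<open>x h = \<psi>(h) h x\<close> gives \<open>(g x\<^sup>i) (h x\<^sup>j) = \<psi>(h)\<^sup>i (g h) x\<^bsup>i+j\<^esup>\<close>.\<close>

definition ore_algebra ::
  "('g, 'm) monoid_scheme \<Rightarrow> ('g \<Rightarrow> 'k::field) \<Rightarrow> ('k, 'g \<times> nat \<Rightarrow>\<^sub>0 'k) module"
  where "ore_algebra G \<psi> =
    \<lparr>carrier = fspace (carrier G \<times> UNIV),
     monoid.mult = (\<lambda>p q. \<Sum>(g, i)\<in>Poly_Mapping.keys p. \<Sum>(h, j)\<in>Poly_Mapping.keys q.
       Poly_Mapping.single (g \<otimes>\<^bsub>G\<^esub> h, i + j)
         (Poly_Mapping.lookup p (g, i) * Poly_Mapping.lookup q (h, j) * \<psi> h ^ i)),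
     one = bvec (\<one>\<^bsub>G\<^esub>, 0),
     ring.zero = 0, add = (+), module.smult = fscale\<rparr>"

text \<open>\<open>\<Delta>\<close> is the algebra map and \<open>S\<close> the algebra antihomomorphism extending the values on
  generators, whence \<open>\<Delta>(g x\<^sup>i) = \<Delta>(g) \<Delta>(x)\<^sup>i\<close> and \<open>S(g x\<^sup>i) = S(x)\<^sup>i S(g)\<close>.\<close>

definition hopf_ore ::
  "('g, 'm) monoid_scheme \<Rightarrow> ('g \<Rightarrow> 'k::field) \<Rightarrow> 'g \<Rightarrow> ('k, 'g \<times> nat \<Rightarrow>\<^sub>0 'k) hopf_algebra"
  where "hopf_ore G \<psi> a =
    (let A = ore_algebra G \<psi>;
         AA = tensor A A;
         grp = (\<lambda>g. bvec (g, 0));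
         x = bvec (\<one>\<^bsub>G\<^esub>, 1)
     in
    \<lparr>carrier = carrier A, monoid.mult = monoid.mult A, one = \<one>\<^bsub>A\<^esub>, ring.zero = \<zero>\<^bsub>A\<^esub>, add = add A,
     module.smult = module.smult A,
     comult = (\<lambda>p. \<Oplus>\<^bsub>AA\<^esub>b\<in>Poly_Mapping.keys p. Poly_Mapping.lookup p b \<odot>\<^bsub>AA\<^esub>
       (pure_tensor A A (grp (fst b)) (grp (fst b)) \<otimes>\<^bsub>AA\<^esub>
         (pure_tensor A A x (grp a) \<oplus>\<^bsub>AA\<^esub> pure_tensor A A \<one>\<^bsub>A\<^esub> x) [^]\<^bsub>AA\<^esub> snd b)),
     counit = (\<lambda>p. \<Sum>(g, i)\<in>Poly_Mapping.keys p.
       if i = 0 then Poly_Mapping.lookup p (g, i) else 0),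
     antipode = (\<lambda>p. \<Oplus>\<^bsub>A\<^esub>b\<in>Poly_Mapping.keys p. Poly_Mapping.lookup p b \<odot>\<^bsub>A\<^esub>
       ((\<ominus>\<^bsub>A\<^esub> (x \<otimes>\<^bsub>A\<^esub> grp (inv\<^bsub>G\<^esub> a))) [^]\<^bsub>A\<^esub> snd b \<otimes>\<^bsub>A\<^esub> grp (inv\<^bsub>G\<^esub> (fst b))))\<rparr>)"

text \<open>\<open>V\<^sub>t(\<rho>)\<close> over \<open>kG(\<chi>\<^sup>-\<^sup>1, a, 0)\<close> has basis \<open>m\<^sub>j\<close>, \<open>j < t\<close>, and \<open>g x\<^sup>i\<close> acts by
  \<open>m\<^sub>j \<mapsto> \<chi>(g)\<^bsup>i+j\<^esup> \<rho>(g) m\<^bsub>i+j\<^esub>\<close>, where \<open>m\<^sub>n = 0\<close> for \<open>n \<ge> t\<close>.\<close>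

definition V_module ::
  "('g \<Rightarrow> 'k::field) \<Rightarrow> nat \<Rightarrow> ('g \<Rightarrow> 'k) \<Rightarrow> ('g \<times> nat \<Rightarrow>\<^sub>0 'k, nat \<Rightarrow>\<^sub>0 'k) module"
  where "V_module \<chi> t \<rho> =
    \<lparr>carrier = fspace {..<t}, monoid.mult = undefined, one = undefined,
     ring.zero = 0, add = (+),
     module.smult = (\<lambda>p v. \<Sum>(g, i)\<in>Poly_Mapping.keys p. \<Sum>j\<in>Poly_Mapping.keys v.
       if i + j < t
       then Poly_Mapping.single (i + j)
         (Poly_Mapping.lookup p (g, i) * Poly_Mapping.lookup v j * (\<chi> g ^ (i + j) * \<rho> g))
       else 0)\<rparr>"

end

theory Submission
  imports Defs
begin

text \<open>Taking coordinates identifies \<open>V\<^sub>s(\<rho>) \<otimes> V\<^sub>t(\<sigma>)\<close> with the space on the basis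
  \<open>m\<^sub>p \<otimes> n\<^sub>r\<close> (\<open>p < s\<close>, \<open>r < t\<close>), graded by \<open>p + r\<close>: \<open>g\<close> acts on degree \<open>d\<close> by the scalar
  \<open>\<chi>\<^sup>d(g) \<rho>(g) \<sigma>(g)\<close> and \<open>x\<close> by an operator \<open>X\<close> of degree 1.  As for quantum \<open>sl\<^sub>2\<close> there is an
  operator \<open>Y\<close> of degree \<open>-1\<close> such that \<open>Y X - X Y\<close> is a scalar on each degree.  In each degree
  \<open>i < min s t\<close> there is a vector \<open>w\<^sub>i\<close> with \<open>Y w\<^sub>i = 0\<close>, and \<open>Y X\<^sup>l w\<^sub>i\<close> is a multiple of
  \<open>X\<^bsup>l-1\<^esup> w\<^sub>i\<close> that is nonzero for \<open>1 \<le> l < s + t - 1 - 2i\<close>, because \<open>\<chi>(a)\<close> is not a root of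
  unity.  Hence the \<open>X\<^sup>l w\<^sub>i\<close> with \<open>l < s + t - 1 - 2i\<close> are linearly independent; there are \<open>s t\<close>
  of them, so they form a basis, and \<open>X\<close> kills the last vector of each string.  The string of
  \<open>w\<^sub>i\<close> is the summand \<open>V\<^bsub>s+t-1-2i\<^esub>(\<chi>\<^sup>i\<rho>\<sigma>)\<close>.\<close>

interpretation fs: vector_space "fscale :: 'k::field \<Rightarrow> ('b \<Rightarrow>\<^sub>0 'k) \<Rightarrow> ('b \<Rightarrow>\<^sub>0 'k)"
  by (rule vector_space_fscale)

section \<open>Linear extension of maps on a basis\<close>

text \<open>Products, actions and \<Delta> are all instances or iterates of this map, so that
  identities between them can be checked on basis vectors.\<close>

definition lext :: "('b \<Rightarrow> ('c \<Rightarrow>\<^sub>0 'k::field)) \<Rightarrow> ('b \<Rightarrow>\<^sub>0 'k) \<Rightarrow> ('c \<Rightarrow>\<^sub>0 'k)"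
  where "lext f p = (\<Sum>b\<in>Poly_Mapping.keys p. fscale (Poly_Mapping.lookup p b) (f b))"

abbreviation lin :: "(('b \<Rightarrow>\<^sub>0 'k::field) \<Rightarrow> ('c \<Rightarrow>\<^sub>0 'k)) \<Rightarrow> bool"
  where "lin \<equiv> Vector_Spaces.linear fscale fscale"

lemma lin_iff: "lin F \<longleftrightarrow> (\<forall>x y. F (x + y) = F x + F y) \<and> (\<forall>c x. F (fscale c x) = fscale c (F x))"
  by (simp add: Vector_Spaces.linear_iff vector_space_fscale)

lemma fscale_single [simp]: "fscale c (Poly_Mapping.single b d) = Poly_Mapping.single b (c * d)"
  by (rule poly_mapping_eqI) (simp add: lookup_single when_def)

text \<open>Summing over a common finite set makes additivity termwise: the support of
  \<open>p + q\<close> may be smaller than the union of the supports.\<close>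

lemma lext_superset:
  assumes "finite S" "Poly_Mapping.keys p \<subseteq> S"
  shows "lext f p = (\<Sum>b\<in>S. fscale (Poly_Mapping.lookup p b) (f b))"
  unfolding lext_def by (rule sum.mono_neutral_left) (use assms in \<open>auto simp: in_keys_iff\<close>)

lemma lext_add: "lext f (p + q) = lext f p + lext f q"
proof -
  let ?S = "Poly_Mapping.keys p \<union> Poly_Mapping.keys q"
  show ?thesis
    using keys_add[of p q]
    by (simp add: lext_superset[of ?S] lookup_add fs.scale_left_distrib sum.distrib)
qed

lemma lext_scale: "lext f (fscale c p) = fscale c (lext f p)"
proof -
  have "Poly_Mapping.keys (fscale c p) \<subseteq> Poly_Mapping.keys p"
    by (auto simp: in_keys_iff)
  then show ?thesis
    by (simp add: lext_superset[of "Poly_Mapping.keys p"] fs.scale_sum_right)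
qed

lemma lin_lext [simp]: "lin (lext f)"
  by (simp add: lin_iff lext_add lext_scale)

lemma lext_single [simp]: "lext f (Poly_Mapping.single b c) = fscale c (f b)"
  by (auto simp: lext_superset[of "{b}"])

lemma lext_zero [simp]: "lext f 0 = 0"
  by (simp add: lext_def)

lemma lin_add: "lin F \<Longrightarrow> F (x + y) = F x + F y"
  and lin_scale: "lin F \<Longrightarrow> F (fscale c x) = fscale c (F x)"
  by (auto simp: lin_iff)

lemma lin_zero: "lin F \<Longrightarrow> F 0 = 0"
  using lin_scale[of F 0 0] by simp

lemma lin_uminus: "lin F \<Longrightarrow> F (- x) = - F x"
  using lin_scale[of F "-1" x] by simp

lemma lin_diff: "lin F \<Longrightarrow> F (x - y) = F x - F y"
  using lin_add[of F x "- y"] by (simp add: lin_uminus)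

lemma lin_sum: "lin F \<Longrightarrow> F (sum f S) = (\<Sum>i\<in>S. F (f i))"
  by (induction S rule: infinite_finite_induct) (auto simp: lin_zero lin_add)

lemma lin_compose: "lin F \<Longrightarrow> lin F' \<Longrightarrow> lin (\<lambda>x. F (F' x))"
  by (simp add: lin_iff)

lemma lin_id: "lin (\<lambda>x. x)"
  by (simp add: lin_iff)

lemma lin_fun_add: "lin F \<Longrightarrow> lin F' \<Longrightarrow> lin (\<lambda>x. F x + F' x)"
  by (simp add: lin_iff fs.scale_right_distrib)

lemma lin_fun_scale: "lin F \<Longrightarrow> lin (\<lambda>x. fscale c (F x))"
  by (simp add: lin_iff fs.scale_right_distrib mult.commute)

lemma lin_fun_sum: "(\<And>i. i \<in> S \<Longrightarrow> lin (F i)) \<Longrightarrow> lin (\<lambda>x. \<Sum>i\<in>S. F i x)"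
  by (simp add: lin_iff sum.distrib fs.scale_sum_right)

lemma lin_fun_lext: "(\<And>b. lin (F b)) \<Longrightarrow> lin (\<lambda>x. lext (\<lambda>b. F b x) p)"
  unfolding lext_def by (intro lin_fun_sum lin_fun_scale)

lemma lin_funpow:
  fixes F :: "('b \<Rightarrow>\<^sub>0 'k::field) \<Rightarrow> ('b \<Rightarrow>\<^sub>0 'k)"
  shows "lin F \<Longrightarrow> lin (F ^^ n)"
  by (induction n) (auto simp: lin_iff)

lemma lext_bvec [simp]: "lext bvec p = p"
  by (rule poly_mapping_eqI) (simp add: lext_def lookup_sum lookup_single when_def in_keys_iff)

lemma lin_eq_lext: "lin F \<Longrightarrow> F p = lext (\<lambda>b. F (bvec b)) p"
proof -
  assume F: "lin F"
  have "F p = F (lext bvec p)" by simp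
  also have "\<dots> = lext (\<lambda>b. F (bvec b)) p"
    unfolding lext_def by (simp only: lin_sum[OF F] lin_scale[OF F])
  finally show ?thesis .
qed

lemma lext_cong: "p \<in> fspace B \<Longrightarrow> (\<And>b. b \<in> B \<Longrightarrow> f b = f' b) \<Longrightarrow> lext f p = lext f' p"
  unfolding lext_def fspace_def by (rule sum.cong) auto

lemma lin_eqI:
  assumes "lin F" "lin F'" "p \<in> fspace B" "\<And>b. b \<in> B \<Longrightarrow> F (bvec b) = F' (bvec b)"
  shows "F p = F' p"
  unfolding lin_eq_lext[OF assms(1), of p] lin_eq_lext[OF assms(2), of p]
  by (rule lext_cong[OF assms(3)]) (rule assms(4))

lemma bilin_eqI:
  assumes "\<And>q. lin (\<lambda>p. F p q)" "\<And>q. lin (\<lambda>p. F' p q)" "\<And>p. lin (F p)" "\<And>p. lin (F' p)"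
    and "p \<in> fspace B" "q \<in> fspace C"
    and "\<And>b c. b \<in> B \<Longrightarrow> c \<in> C \<Longrightarrow> F (bvec b) (bvec c) = F' (bvec b) (bvec c)"
  shows "F p q = F' p q"
  by (rule lin_eqI[OF assms(1,2,5)], rule lin_eqI[OF assms(3,4,6)], rule assms(7))

section \<open>Coordinate subspaces and dimension\<close>

lemma fspace_iff: "p \<in> fspace B \<longleftrightarrow> (\<forall>b. b \<notin> B \<longrightarrow> Poly_Mapping.lookup p b = 0)"
  by (auto simp: fspace_def in_keys_iff)

lemma subspace_fspace: "fs.subspace (fspace B)"
  by (auto simp: fs.subspace_def fspace_iff lookup_add)

lemmas fspace_zero [simp, intro] = fs.subspace_0[OF subspace_fspace]
  and fspace_add [simp, intro] = fs.subspace_add[OF subspace_fspace]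
  and fspace_scale [simp, intro] = fs.subspace_scale[OF subspace_fspace]
  and fspace_diff [simp, intro] = fs.subspace_diff[OF subspace_fspace]
  and fspace_uminus [simp, intro] = fs.subspace_neg[OF subspace_fspace]
  and fspace_sum = fs.subspace_sum[OF subspace_fspace]

lemma fspace_UNIV [simp]: "p \<in> fspace UNIV"
  by (simp add: fspace_iff)

lemma fspace_single [simp]: "b \<in> B \<Longrightarrow> Poly_Mapping.single b c \<in> fspace B"
  by (auto simp: fspace_iff lookup_single when_def)

lemma lext_fspace: "p \<in> fspace B \<Longrightarrow> (\<And>b. b \<in> B \<Longrightarrow> f b \<in> fspace C) \<Longrightarrow> lext f p \<in> fspace C"
  unfolding lext_def by (intro fspace_sum fspace_scale) (auto simp: fspace_def)

lemma span_bvec: "fs.span (bvec ` B) = fspace B"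
proof (rule fs.span_unique)
  fix T :: "('a \<Rightarrow>\<^sub>0 'b) set" assume T: "bvec ` B \<subseteq> T" "fs.subspace T"
  show "fspace B \<subseteq> T"
  proof
    fix p :: "'a \<Rightarrow>\<^sub>0 'b" assume p: "p \<in> fspace B"
    have "lext bvec p \<in> T" unfolding lext_def
      by (intro fs.subspace_sum fs.subspace_scale T) (use p T in \<open>auto simp: fspace_def\<close>)
    then show "p \<in> T" by simp
  qed
qed (auto simp: subspace_fspace)

lemma independent_bvec: "fs.independent (bvec ` B :: ('b \<Rightarrow>\<^sub>0 'k::field) set)"
proof
  assume "fs.dependent (bvec ` B :: ('b \<Rightarrow>\<^sub>0 'k) set)"
  then obtain v :: "'b \<Rightarrow>\<^sub>0 'k" where v: "v \<in> bvec ` B" "v \<in> fs.span (bvec ` B - {v})"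
    unfolding fs.dependent_def by blast
  then obtain b where b: "v = bvec b" "b \<in> B" by auto
  have "bvec ` B - {v} \<subseteq> (bvec ` (B - {b}) :: ('b \<Rightarrow>\<^sub>0 'k) set)" using b by auto
  then have "v \<in> fspace (B - {b})" using v(2) fs.span_mono unfolding span_bvec[symmetric] by blast
  then show False using b by (auto simp: fspace_iff)
qed

lemma inj_bvec: "inj_on (bvec :: 'b \<Rightarrow> ('b \<Rightarrow>\<^sub>0 'k::field)) B"
  by (rule inj_onI) (metis lookup_single_eq lookup_single_not_eq zero_neq_one)

text \<open>A vector of \<open>fspace C\<close> outside the image would extend the image of the
  basis of \<open>fspace B\<close> to \<open>card C + 1\<close> independent vectors in a space
  spanned by \<open>card C\<close> vectors.\<close>

lemma lin_inj_imp_surj: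
  fixes F :: "('b \<Rightarrow>\<^sub>0 'k::field) \<Rightarrow> ('c \<Rightarrow>\<^sub>0 'k)"
  assumes F: "lin F" "\<And>p. p \<in> fspace B \<Longrightarrow> F p \<in> fspace C"
    and inj: "\<And>p. p \<in> fspace B \<Longrightarrow> F p = 0 \<Longrightarrow> p = 0"
    and card: "finite B" "finite C" "card B = card C"
  shows "F ` fspace B = fspace C"
proof -
  interpret vp: vector_space_pair "fscale :: 'k \<Rightarrow> ('b \<Rightarrow>\<^sub>0 'k) \<Rightarrow> _" "fscale :: 'k \<Rightarrow> ('c \<Rightarrow>\<^sub>0 'k) \<Rightarrow> _"
    by unfold_locales
  have injF: "inj_on F (fspace B)"
    by (rule inj_onI) (metis F(1) fspace_diff inj lin_diff right_minus_eq)
  let ?S = "F ` bvec ` B" and ?T = "bvec ` C :: ('c \<Rightarrow>\<^sub>0 'k) set"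
  have ind: "fs.independent ?S"
    by (rule vp.linear_independent_injective_image[OF F(1) independent_bvec]) (simp add: span_bvec injF)
  have cS: "card ?S = card B"
    by (subst card_image) (auto intro: inj_on_subset[OF injF] simp: card_image[OF inj_bvec])
  have span: "fs.span ?S = F ` fspace B"
    using vp.linear_span_image[OF F(1)] by (simp add: span_bvec)
  have "v \<in> fs.span ?S" if v: "v \<in> fspace C" for v
  proof (rule ccontr)
    assume nv: "v \<notin> fs.span ?S"
    then have "fs.independent (insert v ?S)" by (rule fs.independent_insertI) (rule ind)
    moreover have "insert v ?S \<subseteq> fs.span ?T" using v F(2) by (auto simp: span_bvec)
    ultimately have "card (insert v ?S) \<le> card ?T"
      using fs.independent_span_bound[of ?T] card by blast
    moreover have "card (insert v ?S) = Suc (card ?S)"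
    proof (rule card_insert_disjoint)
      show "v \<notin> ?S" using nv fs.span_base[of v ?S] by metis
    qed (simp add: card(1))
    moreover have "card ?T = card C" using inj_bvec by (rule card_image)
    ultimately show False using cS card by simp
  qed
  then show ?thesis using F(2) span by auto
qed

section \<open>Tensor products of coordinate spaces\<close>

text \<open>Common ground of the algebra and of modules with restricted scalars. Scalars are fixed
  on \<open>fspace B\<close> only: restricted scalars act through the unit, which truncates vectors
  outside the carrier of \<open>V_module\<close>.\<close>

definition kspace :: "('k::field, 'b \<Rightarrow>\<^sub>0 'k, 'm) module_scheme \<Rightarrow> 'b set \<Rightarrow> bool"
  where "kspace V B \<longleftrightarrow> carrier V = fspace B \<and> add V = (+) \<and>
    (\<forall>c. \<forall>v\<in>fspace B. c \<odot>\<^bsub>V\<^esub> v = fscale c v)"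

abbreviation rspan ::
  "('k::field, 'v, 'm) module_scheme \<Rightarrow> ('k, 'w, 'n) module_scheme \<Rightarrow> ('v \<times> 'w \<Rightarrow>\<^sub>0 'k) set"
  where "rspan V W \<equiv> fs.span (tensor_relations V W)"

abbreviation fspace2 :: "'b set \<Rightarrow> 'c set \<Rightarrow> (('b \<Rightarrow>\<^sub>0 'k) \<times> ('c \<Rightarrow>\<^sub>0 'k) \<Rightarrow>\<^sub>0 'k::field) set"
  where "fspace2 B C \<equiv> fspace (fspace B \<times> fspace C)"

lemma formal_product_lext:
  "formal_product f f' p q = lext (\<lambda>u. lext (\<lambda>v. bvec (f (fst u) (fst v), f' (snd u) (snd v))) q) p"
  by (simp add: formal_product_def lext_def fs.scale_sum_right)

lemma lin_formal_product: "lin (\<lambda>p. formal_product f f' p q)" "lin (formal_product f f' p)"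
  unfolding formal_product_lext by (auto intro: lin_fun_lext)

lemma formal_product_bvec [simp]:
  "formal_product f f' (bvec (u, u')) (bvec (v, v')) = bvec (f u v, f' u' v')"
  by (simp add: formal_product_lext)

lemma formal_product_fspace:
  assumes "\<And>u v. u \<in> A \<Longrightarrow> v \<in> B \<Longrightarrow> f u v \<in> C" "\<And>u v. u \<in> A' \<Longrightarrow> v \<in> B' \<Longrightarrow> f' u v \<in> C'"
    and "p \<in> fspace (A \<times> A')" "q \<in> fspace (B \<times> B')"
  shows "formal_product f f' p q \<in> fspace (C \<times> C')"
  unfolding formal_product_lext
  by (rule lext_fspace[OF assms(3)], rule lext_fspace[OF assms(4)]) (auto intro!: fspace_single assms(1,2))

text \<open>Holds already for formal sums, before passing to cosets: formal products are bilinear,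
  so each argument may be taken to be a single pair.\<close>

lemma formal_product_assoc:
  assumes "\<And>u v w. u \<in> A \<Longrightarrow> v \<in> B \<Longrightarrow> w \<in> C \<Longrightarrow> f1 (f2 u v) w = f3 u (f4 v w)"
    and "\<And>u v w. u \<in> A' \<Longrightarrow> v \<in> B' \<Longrightarrow> w \<in> C' \<Longrightarrow> f1' (f2' u v) w = f3' u (f4' v w)"
    and p: "p \<in> fspace (A \<times> A')" and q: "q \<in> fspace (B \<times> B')" and r: "r \<in> fspace (C \<times> C')"
  shows "formal_product f1 f1' (formal_product f2 f2' p q) r =
    formal_product f3 f3' p (formal_product f4 f4' q r)"
proof (rule lin_eqI[OF _ _ p], goal_cases)
  case (3 u)
  show ?case
  proof (rule lin_eqI[OF _ _ q], goal_cases)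
    case (3 v)
    show ?case
      by (rule lin_eqI[OF _ _ r])
        (use 3 \<open>u \<in> _\<close> in \<open>auto intro: lin_formal_product lin_compose[OF lin_formal_product(2)] simp: assms(1,2)\<close>)
  qed (auto intro: lin_compose[OF lin_formal_product(1)] lin_compose[OF lin_formal_product(2)] lin_formal_product)
qed (auto intro: lin_compose[OF lin_formal_product(1)] lin_formal_product)

lemma lext_span: "p \<in> fspace B \<Longrightarrow> (\<And>b. b \<in> B \<Longrightarrow> f b \<in> fs.span S) \<Longrightarrow> lext f p \<in> fs.span S"
  unfolding lext_def by (intro fs.span_sum fs.span_scale) (auto simp: fspace_def)

lemma lin_span_image:
  assumes "lin F" "\<And>r. r \<in> R \<Longrightarrow> F r \<in> fs.span S" "r \<in> fs.span R"
  shows "F r \<in> fs.span S"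
  using assms(3)
  by (induction rule: fs.span_induct)
    (auto intro!: fs.subspaceI fs.span_zero fs.span_add fs.span_scale simp: assms(2) lin_zero[OF assms(1)] lin_add[OF assms(1)] lin_scale[OF assms(1)])

lemma kspace_relations:
  assumes "kspace V B" "kspace W C"
  shows "tensor_relations V W =
    {bvec (v + v', w) - bvec (v, w) - bvec (v', w) |v v' w. v \<in> fspace B \<and> v' \<in> fspace B \<and> w \<in> fspace C} \<union>
    {bvec (v, w + w') - bvec (v, w) - bvec (v, w') |v w w'. v \<in> fspace B \<and> w \<in> fspace C \<and> w' \<in> fspace C} \<union>
    {bvec (fscale c v, w) - fscale c (bvec (v, w)) |c v w. v \<in> fspace B \<and> w \<in> fspace C} \<union>
    {bvec (v, fscale c w) - fscale c (bvec (v, w)) |c v w. v \<in> fspace B \<and> w \<in> fspace C}"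
  unfolding tensor_relations_def
  by (intro arg_cong2[where f = "(\<union>)"] Collect_cong iff_exI) (use assms in \<open>auto simp: kspace_def\<close>)

text \<open>Each bilinearity relation goes to one of the same kind, so \<open>F \<otimes> F'\<close>
  descends to the tensor product. A map \<open>T\<close> given on pairs is used so that it can be
  \<open>formal_product\<close> with one argument fixed.\<close>

lemma relations_map:
  assumes k: "kspace V B" "kspace V' B'" "kspace W C" "kspace W' C'"
    and F: "lin F" "\<And>v. v \<in> fspace B \<Longrightarrow> F v \<in> fspace C"
    and F': "lin F'" "\<And>v. v \<in> fspace B' \<Longrightarrow> F' v \<in> fspace C'"
    and T: "lin T" "\<And>v w. v \<in> fspace B \<Longrightarrow> w \<in> fspace B' \<Longrightarrow> T (bvec (v, w)) = bvec (F v, F' w)"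
    and r: "r \<in> rspan V V'"
  shows "T r \<in> rspan W W'"
proof (rule lin_span_image[OF T(1) _ r], rule fs.span_base)
  note lins = lin_diff[OF T(1)] lin_scale[OF T(1)] lin_add[OF F(1)] lin_add[OF F'(1)]
    lin_scale[OF F(1)] lin_scale[OF F'(1)]
  fix r assume "r \<in> tensor_relations V V'"
  then show "T r \<in> tensor_relations W W'"
    unfolding kspace_relations[OF k(1,2)] kspace_relations[OF k(3,4)]
  proof (elim UnE CollectE exE conjE, goal_cases)
    case (1 v v' w)
    then have "T r = bvec (F v + F v', F' w) - bvec (F v, F' w) - bvec (F v', F' w)"
      by (simp add: lins T(2))
    then show ?case using 1 F(2) F'(2) by blast
  next
    case (2 v w w')
    then have "T r = bvec (F v, F' w + F' w') - bvec (F v, F' w) - bvec (F v, F' w')"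
      by (simp add: lins T(2))
    then show ?case using 2 F(2) F'(2) by blast
  next
    case (3 c v w)
    then have "T r = bvec (fscale c (F v), F' w) - fscale c (bvec (F v, F' w))"
      by (simp add: lins T(2) del: fscale_single)
    then show ?case using 3 F(2) F'(2) by blast
  next
    case (4 c v w)
    then have "T r = bvec (F v, fscale c (F' w)) - fscale c (bvec (F v, F' w))"
      by (simp add: lins T(2) del: fscale_single)
    then show ?case using 4 F(2) F'(2) by blast
  qed
qed

text \<open>By linearity in \<open>q\<close> the right factor may be a single pair
  \<open>(v, v')\<close>; the formal product is then the map induced by
  \<open>\<lambda>u. f u v\<close> and \<open>\<lambda>u. f' u v'\<close>, to which
  \<open>relations_map\<close> applies.\<close>

lemma formal_product_relations_left:
  fixes f :: "('a \<Rightarrow>\<^sub>0 'k::field) \<Rightarrow> ('b \<Rightarrow>\<^sub>0 'k) \<Rightarrow> ('c \<Rightarrow>\<^sub>0 'k)"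
    and f' :: "('d \<Rightarrow>\<^sub>0 'k) \<Rightarrow> ('e \<Rightarrow>\<^sub>0 'k) \<Rightarrow> ('f \<Rightarrow>\<^sub>0 'k)"
  assumes k: "kspace U A" "kspace U' A'" "kspace W C" "kspace W' C'"
    and f: "\<And>v. lin (\<lambda>u. f u v)" "\<And>u v. u \<in> fspace A \<Longrightarrow> v \<in> fspace B \<Longrightarrow> f u v \<in> fspace C"
    and f': "\<And>v. lin (\<lambda>u. f' u v)" "\<And>u v. u \<in> fspace A' \<Longrightarrow> v \<in> fspace B' \<Longrightarrow> f' u v \<in> fspace C'"
    and r: "r \<in> rspan U U'" and q: "q \<in> fspace2 B B'"
  shows "formal_product f f' r q \<in> rspan W W'"
proof -
  have "lext (\<lambda>v. formal_product f f' r (bvec v)) q \<in> rspan W W'"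
  proof (rule lext_span[OF q])
    fix b :: "('b \<Rightarrow>\<^sub>0 'k) \<times> ('e \<Rightarrow>\<^sub>0 'k)" assume "b \<in> fspace B \<times> fspace B'"
    then show "formal_product f f' r (bvec b) \<in> rspan W W'"
      by (cases b) (rule relations_map[OF k f(1) _ f'(1) _ lin_formal_product(1) _ r, of "fst b" "snd b"],
        auto intro: f f')
  qed
  then show ?thesis by (simp flip: lin_eq_lext[OF lin_formal_product(2)])
qed

lemma formal_product_relations_right:
  fixes f :: "('a \<Rightarrow>\<^sub>0 'k::field) \<Rightarrow> ('b \<Rightarrow>\<^sub>0 'k) \<Rightarrow> ('c \<Rightarrow>\<^sub>0 'k)"
    and f' :: "('d \<Rightarrow>\<^sub>0 'k) \<Rightarrow> ('e \<Rightarrow>\<^sub>0 'k) \<Rightarrow> ('f \<Rightarrow>\<^sub>0 'k)"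
  assumes k: "kspace V B" "kspace V' B'" "kspace W C" "kspace W' C'"
    and f: "\<And>u. lin (f u)" "\<And>u v. u \<in> fspace A \<Longrightarrow> v \<in> fspace B \<Longrightarrow> f u v \<in> fspace C"
    and f': "\<And>u. lin (f' u)" "\<And>u v. u \<in> fspace A' \<Longrightarrow> v \<in> fspace B' \<Longrightarrow> f' u v \<in> fspace C'"
    and r: "r \<in> rspan V V'" and p: "p \<in> fspace2 A A'"
  shows "formal_product f f' p r \<in> rspan W W'"
proof -
  have "lext (\<lambda>u. formal_product f f' (bvec u) r) p \<in> rspan W W'"
  proof (rule lext_span[OF p])
    fix b :: "('a \<Rightarrow>\<^sub>0 'k) \<times> ('d \<Rightarrow>\<^sub>0 'k)" assume "b \<in> fspace A \<times> fspace A'"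
    then show "formal_product f f' (bvec b) r \<in> rspan W W'"
      by (cases b) (rule relations_map[OF k f(1) _ f'(1) _ lin_formal_product(2) _ r, of "fst b" "snd b"],
        auto intro: f f')
  qed
  then show ?thesis by (simp flip: lin_eq_lext[OF lin_formal_product(1)])
qed

section \<open>Cosets of the bilinearity relations\<close>

lemma mem_tensor_class: "p' \<in> tensor_class V W p \<longleftrightarrow> p' - p \<in> rspan V W"
  by (auto simp: tensor_class_def image_iff intro!: bexI[of _ "p' - p"])

lemma tensor_class_self [simp]: "p \<in> tensor_class V W p"
  by (simp add: mem_tensor_class fs.span_zero)

lemma tensor_class_eq_iff: "tensor_class V W p = tensor_class V W q \<longleftrightarrow> p - q \<in> rspan V W"
proof
  assume "tensor_class V W p = tensor_class V W q"
  then show "p - q \<in> rspan V W" using tensor_class_self[of p V W] by (simp add: mem_tensor_class)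
next
  assume *: "p - q \<in> rspan V W"
  show "tensor_class V W p = tensor_class V W q"
  proof (rule Set.set_eqI, unfold mem_tensor_class, rule iffI)
    fix x
    show "x - q \<in> rspan V W" if "x - p \<in> rspan V W" using fs.span_add[OF that *] by simp
    show "x - p \<in> rspan V W" if "x - q \<in> rspan V W" using fs.span_diff[OF that *] by simp
  qed
qed

text \<open>Evaluates coset operations, which are unions over all representatives: if the value is
  the same for each of them, it is the union, because a coset is nonempty.\<close>

lemma UN_tensor_class:
  assumes "\<And>p'. p' - p \<in> rspan V W \<Longrightarrow> f p' = c"
  shows "(\<Union>p'\<in>tensor_class V W p. f p') = c"
proof -
  have "f p' = c" if "p' \<in> tensor_class V W p" for p' using assms that by (simp add: mem_tensor_class)
  then show ?thesis using tensor_class_self[of p V W] by blast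
qed

lemma tensor_add: "tensor_class V W p \<oplus>\<^bsub>tensor V W\<^esub> tensor_class V W q = tensor_class V W (p + q)"
proof -
  have "tensor_class V W (p' + q') = tensor_class V W (p + q)"
    if "p' - p \<in> rspan V W" "q' - q \<in> rspan V W" for p' q'
    using fs.span_add[OF that] by (simp add: tensor_class_eq_iff add_diff_add)
  then have "(\<Union>p'\<in>tensor_class V W p. \<Union>q'\<in>tensor_class V W q. tensor_class V W (p' + q')) = tensor_class V W (p + q)"
    by (intro UN_tensor_class)
  then show ?thesis by (simp add: tensor_def)
qed

lemma tensor_smult: "c \<odot>\<^bsub>tensor V W\<^esub> tensor_class V W p = tensor_class V W (fscale c p)"
proof -
  have "tensor_class V W (fscale c p') = tensor_class V W (fscale c p)" if "p' - p \<in> rspan V W" for p'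
    using fs.span_scale[OF that, of c] by (simp add: tensor_class_eq_iff fs.scale_right_diff_distrib)
  then have "(\<Union>p'\<in>tensor_class V W p. tensor_class V W (fscale c p')) = tensor_class V W (fscale c p)"
    by (intro UN_tensor_class)
  then show ?thesis by (simp add: tensor_def)
qed

lemma rspan_subset: "kspace V B \<Longrightarrow> kspace W C \<Longrightarrow> rspan V W \<subseteq> fspace2 B C"
  by (rule fs.span_minimal[OF _ subspace_fspace])
    (auto simp: tensor_relations_def kspace_def intro!: fspace_diff)

lemma tensor_carrier: "kspace V B \<Longrightarrow> kspace W C \<Longrightarrow> carrier (tensor V W) = tensor_class V W ` fspace2 B C"
  by (simp add: tensor_def kspace_def)

lemma tensor_mult:
  assumes k: "kspace V B" "kspace W C"
    and m: "\<And>u v. u \<otimes>\<^bsub>V\<^esub> v = f u v" "\<And>u v. u \<otimes>\<^bsub>W\<^esub> v = f' u v"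
    and f: "\<And>v. lin (\<lambda>u. f u v)" "\<And>u. lin (f u)" "\<And>u v. u \<in> fspace B \<Longrightarrow> v \<in> fspace B \<Longrightarrow> f u v \<in> fspace B"
    and f': "\<And>v. lin (\<lambda>u. f' u v)" "\<And>u. lin (f' u)" "\<And>u v. u \<in> fspace C \<Longrightarrow> v \<in> fspace C \<Longrightarrow> f' u v \<in> fspace C"
    and p: "p \<in> fspace2 B C" and q: "q \<in> fspace2 B C"
  shows "tensor_class V W p \<otimes>\<^bsub>tensor V W\<^esub> tensor_class V W q = tensor_class V W (formal_product f f' p q)"
proof -
  have "tensor_class V W (formal_product f f' p' q') = tensor_class V W (formal_product f f' p q)"
    if p': "p' - p \<in> rspan V W" and q': "q' - q \<in> rspan V W" for p' q'
  proof -
    have "(q' - q) + q \<in> fspace2 B C"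
      by (rule fspace_add) (use rspan_subset[OF k] q' q in auto)
    \<comment> \<open>The difference is split as p'q' - pq = (p' - p)q' + p(q' - q), with a
      combination of relations as a factor of each term.\<close>
    then have "formal_product f f' (p' - p) q' + formal_product f f' p (q' - q) \<in> rspan V W"
      by (intro fs.span_add formal_product_relations_left[OF k k f(1,3) f'(1,3) p']
        formal_product_relations_right[OF k k f(2,3) f'(2,3) q' p]) auto
    then show ?thesis unfolding tensor_class_eq_iff
      by (simp add: lin_diff[OF lin_formal_product(1)] lin_diff[OF lin_formal_product(2)])
  qed
  then have "(\<Union>p'\<in>tensor_class V W p. \<Union>q'\<in>tensor_class V W q.
      tensor_class V W (formal_product f f' p' q')) = tensor_class V W (formal_product f f' p q)"
    by (intro UN_tensor_class)
  then show ?thesis by (simp add: tensor_def m)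
qed

text \<open>Enough structure for the finite sum in the definition of \<Delta>.\<close>

lemma tensor_abelian_monoid:
  assumes k: "kspace V B" "kspace W C"
  shows "abelian_monoid (tensor V W)"
proof -
  have "\<zero>\<^bsub>tensor V W\<^esub> = tensor_class V W 0" by (simp add: tensor_def)
  then show ?thesis
    by (intro abelian_monoidI) (auto simp: tensor_carrier[OF k] tensor_add add_ac)
qed

lemma tensor_finsum:
  assumes k: "kspace V B" "kspace W C" and "finite K" "\<And>b. b \<in> K \<Longrightarrow> f b \<in> fspace2 B C"
  shows "(\<Oplus>\<^bsub>tensor V W\<^esub>b\<in>K. tensor_class V W (f b)) = tensor_class V W (\<Sum>b\<in>K. f b)"
proof -
  interpret abelian_monoid "tensor V W" by (rule tensor_abelian_monoid[OF k])
  show ?thesis using assms(3,4)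
  proof (induction K rule: finite_induct)
    case empty
    show ?case unfolding finsum_empty by (simp add: tensor_def)
  next
    case (insert b K)
    then show ?case
      by (subst finsum_insert) (auto simp: tensor_carrier[OF k] tensor_add)
  qed
qed


section \<open>Coordinates on the tensor product\<close>

definition tens :: "('b \<Rightarrow>\<^sub>0 'k::field) \<Rightarrow> ('c \<Rightarrow>\<^sub>0 'k) \<Rightarrow> ('b \<times> 'c \<Rightarrow>\<^sub>0 'k)"
  where "tens v w = lext (\<lambda>i. lext (\<lambda>j. bvec (i, j)) w) v"

text \<open>On cosets this is the isomorphism of the tensor product with the space on the basis
  \<open>B \<times> C\<close>; \<open>lift\<close> is the section that picks
  representatives.\<close>

definition coord :: "(('b \<Rightarrow>\<^sub>0 'k) \<times> ('c \<Rightarrow>\<^sub>0 'k) \<Rightarrow>\<^sub>0 'k::field) \<Rightarrow> ('b \<times> 'c \<Rightarrow>\<^sub>0 'k)"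
  where "coord = lext (\<lambda>(v, w). tens v w)"

definition lift :: "('b \<times> 'c \<Rightarrow>\<^sub>0 'k::field) \<Rightarrow> (('b \<Rightarrow>\<^sub>0 'k) \<times> ('c \<Rightarrow>\<^sub>0 'k) \<Rightarrow>\<^sub>0 'k)"
  where "lift = lext (\<lambda>(i, j). bvec (bvec i, bvec j))"

lemma lin_tens: "lin (\<lambda>v. tens v w)" "lin (tens v)"
  unfolding tens_def by (auto intro: lin_fun_lext)

lemma tens_single [simp]: "tens (Poly_Mapping.single i c) (Poly_Mapping.single j d) = Poly_Mapping.single (i, j) (c * d)"
  by (simp add: tens_def)

lemma tens_zero [simp]: "tens 0 w = 0" "tens v 0 = 0"
  by (simp_all add: lin_zero lin_tens lin_zero[OF lin_tens(1)])

lemma lin_coord: "lin coord" and lin_lift: "lin lift"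
  by (simp_all add: coord_def lift_def)

lemma coord_bvec [simp]: "coord (bvec (v, w)) = tens v w"
  by (simp add: coord_def)

lemma lift_bvec [simp]: "lift (bvec (i, j)) = bvec (bvec i, bvec j)"
  by (simp add: lift_def)

lemma coord_lift: "coord (lift u) = u"
  by (rule lin_eqI[where B = UNIV]) (auto intro: lin_compose lin_coord lin_lift lin_id)

lemma tens_fspace: "v \<in> fspace B \<Longrightarrow> w \<in> fspace C \<Longrightarrow> tens v w \<in> fspace (B \<times> C)"
  unfolding tens_def by (intro lext_fspace[where B = B] lext_fspace[where B = C]) auto

lemma coord_fspace: "p \<in> fspace2 B C \<Longrightarrow> coord p \<in> fspace (B \<times> C)"
  unfolding coord_def by (rule lext_fspace) (auto intro: tens_fspace)

lemma lift_fspace: "u \<in> fspace (B \<times> C) \<Longrightarrow> lift u \<in> fspace2 B C"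
  unfolding lift_def by (rule lext_fspace) auto

lemma coord_relations:
  assumes k: "kspace V B" "kspace W C" and r: "r \<in> rspan V W"
  shows "coord r = 0"
proof -
  have "coord r \<in> fs.span {}"
  proof (rule lin_span_image[OF lin_coord _ r])
    fix r assume "r \<in> tensor_relations V W"
    then show "coord r \<in> fs.span {}"
      unfolding kspace_relations[OF k]
      by (elim UnE CollectE exE conjE)
        (simp_all add: lin_diff[OF lin_coord] lin_scale[OF lin_coord] lin_add[OF lin_tens(1)] lin_add[OF lin_tens(2)]
          lin_scale[OF lin_tens(1)] lin_scale[OF lin_tens(2)] del: fscale_single)
  qed
  then show ?thesis by simp
qed

text \<open>The defect \<open>E v w\<close> of a pair is bilinear modulo the relations and vanishes
  on pairs of basis vectors, so it is a combination of relations for every pair. A general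
  \<open>p\<close> is a linear combination of pairs.\<close>

lemma lift_coord:
  fixes p :: "('b \<Rightarrow>\<^sub>0 'k::field) \<times> ('c \<Rightarrow>\<^sub>0 'k) \<Rightarrow>\<^sub>0 'k"
  assumes k: "kspace V B" "kspace W C" and p: "p \<in> fspace2 B C"
  shows "p - lift (coord p) \<in> rspan V W"
proof -
  have rel: "bvec (v + v', w) - bvec (v, w) - bvec (v', w) \<in> rspan V W"
    "bvec (fscale c v, w) - fscale c (bvec (v, w)) \<in> rspan V W"
    if "v \<in> fspace B" "v' \<in> fspace B" "w \<in> fspace C" for v v' w c
    using that by (auto intro!: fs.span_base simp: kspace_relations[OF k] simp del: fscale_single)
  have rel': "bvec (v, w + w') - bvec (v, w) - bvec (v, w') \<in> rspan V W"
    "bvec (v, fscale c w) - fscale c (bvec (v, w)) \<in> rspan V W"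
    if "v \<in> fspace B" "w \<in> fspace C" "w' \<in> fspace C" for v w w' c
    using that by (auto intro!: fs.span_base simp: kspace_relations[OF k] simp del: fscale_single)
  define E where "E v w = bvec (v, w) - lift (tens v w)" for v :: "'b \<Rightarrow>\<^sub>0 'k" and w :: "'c \<Rightarrow>\<^sub>0 'k"
  have E: "E (v + v') w - E v w - E v' w \<in> rspan V W" "E (fscale c v) w - fscale c (E v w) \<in> rspan V W"
    if "v \<in> fspace B" "v' \<in> fspace B" "w \<in> fspace C" for v v' w c
    using rel(1)[OF that] rel(2)[OF that, of c] unfolding E_def
    by (simp_all add: lin_add[OF lin_tens(1)] lin_scale[OF lin_tens(1)] lin_add[OF lin_lift] lin_scale[OF lin_lift]
      fs.scale_right_diff_distrib algebra_simps del: fscale_single)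
  have E': "E v (w + w') - E v w - E v w' \<in> rspan V W" "E v (fscale c w) - fscale c (E v w) \<in> rspan V W"
    if "v \<in> fspace B" "w \<in> fspace C" "w' \<in> fspace C" for v w w' c
    using rel'(1)[OF that] rel'(2)[OF that, of c] unfolding E_def
    by (simp_all add: lin_add[OF lin_tens(2)] lin_scale[OF lin_tens(2)] lin_add[OF lin_lift] lin_scale[OF lin_lift]
      fs.scale_right_diff_distrib algebra_simps del: fscale_single)
  have add: "x \<in> rspan V W" if "x - y - z \<in> rspan V W" "y \<in> rspan V W" "z \<in> rspan V W" for x y z
    using fs.span_add[OF fs.span_add[OF that(1,2)] that(3)] by simp
  have scale: "x \<in> rspan V W" if "x - fscale c y \<in> rspan V W" "y \<in> rspan V W" for x y c
    using fs.span_add[OF that(1) fs.span_scale[OF that(2), of c]] by simp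
  have zero: "E 0 w \<in> rspan V W" if "w \<in> fspace C" for w
    using E(2)[of 0 0 w 0] that by simp
  have zero': "E v 0 \<in> rspan V W" if "v \<in> fspace B" for v
    using E'(2)[of v 0 0 0] that by simp
  have base: "E (bvec i) (bvec j) \<in> rspan V W" for i j
    by (simp add: E_def fs.span_zero)
  \<comment> \<open>The two arguments are extended from basis vectors to their span one after the
    other, the right one first.\<close>
  have 1: "E (bvec i) w \<in> rspan V W" if i: "i \<in> B" and w: "w \<in> fspace C" for i w
  proof -
    have "fspace C \<subseteq> {w \<in> fspace C. E (bvec i) w \<in> rspan V W}"
      unfolding span_bvec[symmetric] using i
      by (intro fs.span_minimal fs.subspaceI; simp add: span_bvec zero zero')
        (auto intro: add[OF E'(1)] scale[OF E'(2)] simp: base)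
    then show ?thesis using w by blast
  qed
  have 2: "E v w \<in> rspan V W" if v: "v \<in> fspace B" and w: "w \<in> fspace C" for v w
  proof -
    have "fspace B \<subseteq> {v \<in> fspace B. E v w \<in> rspan V W}"
      unfolding span_bvec[symmetric] using w
      by (intro fs.span_minimal fs.subspaceI; simp add: span_bvec zero zero')
        (auto intro: add[OF E(1)] scale[OF E(2)] 1)
    then show ?thesis using v by blast
  qed
  have "lext (\<lambda>b. E (fst b) (snd b)) p \<in> rspan V W"
    by (rule lext_span[OF p]) (auto intro: 2)
  also have "lext (\<lambda>b. E (fst b) (snd b)) p = p - lift (coord p)"
    by (rule lin_eqI[where B = UNIV])
      (auto simp: E_def lin_iff lin_add[OF lin_lift] lin_add[OF lin_coord] lin_scale[OF lin_lift] lin_scale[OF lin_coord]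
        lext_add lext_scale fs.scale_right_diff_distrib)
  finally show ?thesis .
qed

text \<open>By \<open>coord_relations\<close> and \<open>lift_coord\<close> the span of the
  relations is the kernel of \<open>coord\<close> on \<open>fspace2 B C\<close>.\<close>

lemma tensor_class_eq_iff_coord:
  assumes k: "kspace V B" "kspace W C" and p: "p \<in> fspace2 B C" "q \<in> fspace2 B C"
  shows "tensor_class V W p = tensor_class V W q \<longleftrightarrow> coord p = coord q"
proof
  assume "tensor_class V W p = tensor_class V W q"
  then show "coord p = coord q"
    using coord_relations[OF k, of "p - q"] by (simp add: tensor_class_eq_iff lin_diff[OF lin_coord])
next
  assume "coord p = coord q"
  then show "tensor_class V W p = tensor_class V W q"
    using lift_coord[OF k, of "p - q"] p
    by (simp add: tensor_class_eq_iff lin_diff[OF lin_coord] lin_zero[OF lin_lift])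
qed

section \<open>Modules over the Hopf algebra\<close>

text \<open>The sums defining the product and, in \<open>vact\<close>, the action are rewritten
  through \<open>lext\<close>, which makes their bilinearity visible.\<close>

definition omul :: "('g, 'm) monoid_scheme \<Rightarrow> ('g \<Rightarrow> 'k::field) \<Rightarrow> ('g \<times> nat \<Rightarrow>\<^sub>0 'k) \<Rightarrow> ('g \<times> nat \<Rightarrow>\<^sub>0 'k) \<Rightarrow> ('g \<times> nat \<Rightarrow>\<^sub>0 'k)"
  where "omul G \<psi> p q = lext (\<lambda>u. lext (\<lambda>v. Poly_Mapping.single (fst u \<otimes>\<^bsub>G\<^esub> fst v, snd u + snd v) (\<psi> (fst v) ^ snd u)) q) p"

definition vact :: "('g \<Rightarrow> 'k::field) \<Rightarrow> nat \<Rightarrow> ('g \<Rightarrow> 'k) \<Rightarrow> ('g \<times> nat \<Rightarrow>\<^sub>0 'k) \<Rightarrow> (nat \<Rightarrow>\<^sub>0 'k) \<Rightarrow> (nat \<Rightarrow>\<^sub>0 'k)"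
  where "vact \<chi> t \<rho> p v = lext (\<lambda>u. lext (\<lambda>j. if snd u + j < t
    then Poly_Mapping.single (snd u + j) (\<chi> (fst u) ^ (snd u + j) * \<rho> (fst u)) else 0) v) p"

lemma ore_algebra_mult: "p \<otimes>\<^bsub>ore_algebra G \<psi>\<^esub> q = omul G \<psi> p q"
  by (simp add: ore_algebra_def omul_def lext_def fs.scale_sum_right case_prod_unfold mult.assoc)

lemma V_module_smult: "p \<odot>\<^bsub>V_module \<chi> t \<rho>\<^esub> v = vact \<chi> t \<rho> p v"
  unfolding V_module_def vact_def lext_def fs.scale_sum_right
  by (auto simp: case_prod_unfold mult.assoc intro!: sum.cong)

lemma lin_omul: "lin (\<lambda>p. omul G \<psi> p q)" "lin (omul G \<psi> p)"
  unfolding omul_def by (auto intro: lin_fun_lext)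

lemma lin_vact: "lin (\<lambda>p. vact \<chi> t \<rho> p v)" "lin (vact \<chi> t \<rho> p)"
  unfolding vact_def by (auto intro: lin_fun_lext)

lemma omul_single [simp]: "omul G \<psi> (Poly_Mapping.single (g, i) c) (Poly_Mapping.single (h, j) d) =
  Poly_Mapping.single (g \<otimes>\<^bsub>G\<^esub> h, i + j) (c * d * \<psi> h ^ i)"
  by (simp add: omul_def mult.assoc)

lemma vact_single [simp]: "vact \<chi> t \<rho> (Poly_Mapping.single (g, i) c) (Poly_Mapping.single j d) =
  (if i + j < t then Poly_Mapping.single (i + j) (c * d * \<chi> g ^ (i + j) * \<rho> g) else 0)"
  by (simp add: vact_def mult.assoc)

lemma vact_zero [simp]: "vact \<chi> t \<rho> p 0 = 0"
  by (simp add: lin_zero lin_vact)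

lemma vact_fspace: "vact \<chi> t \<rho> p v \<in> fspace {..<t}"
  unfolding vact_def by (intro lext_fspace[where B = UNIV]) auto

text \<open>For finite \<open>I\<close> the carrier is the full product, so every axiom holds
  componentwise.\<close>

lemma left_module_direct_sum:
  assumes "finite I" and R: "ring R" and M: "\<And>i. i \<in> I \<Longrightarrow> left_module R (M i)"
  shows "left_module R (direct_sum I M)"
proof -
  have carr: "carrier (direct_sum I M) = (\<Pi>\<^sub>E i\<in>I. carrier (M i))"
    using \<open>finite I\<close> by (auto simp: direct_sum_def)
  have ag: "abelian_group (M i)" if "i \<in> I" for i
    using M[OF that] by (simp add: left_module_def)
  have ab: "abelian_group (direct_sum I M)"
  proof (rule abelian_groupI, unfold carr)
    fix f g assume "f \<in> (\<Pi>\<^sub>E i\<in>I. carrier (M i))" "g \<in> (\<Pi>\<^sub>E i\<in>I. carrier (M i))"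
    then show "f \<oplus>\<^bsub>direct_sum I M\<^esub> g \<in> (\<Pi>\<^sub>E i\<in>I. carrier (M i))"
      "f \<oplus>\<^bsub>direct_sum I M\<^esub> g = g \<oplus>\<^bsub>direct_sum I M\<^esub> f"
      using ag by (auto simp: direct_sum_def abelian_groupE PiE_iff intro!: restrict_ext)
  next
    fix f g h assume "f \<in> (\<Pi>\<^sub>E i\<in>I. carrier (M i))" "g \<in> (\<Pi>\<^sub>E i\<in>I. carrier (M i))" "h \<in> (\<Pi>\<^sub>E i\<in>I. carrier (M i))"
    then show "f \<oplus>\<^bsub>direct_sum I M\<^esub> g \<oplus>\<^bsub>direct_sum I M\<^esub> h = f \<oplus>\<^bsub>direct_sum I M\<^esub> (g \<oplus>\<^bsub>direct_sum I M\<^esub> h)"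
      using ag by (auto simp: direct_sum_def abelian_groupE(1,3) PiE_iff intro!: restrict_ext)
  next
    fix f assume f: "f \<in> (\<Pi>\<^sub>E i\<in>I. carrier (M i))"
    then show "\<zero>\<^bsub>direct_sum I M\<^esub> \<oplus>\<^bsub>direct_sum I M\<^esub> f = f"
      using ag by (auto simp: direct_sum_def abelian_groupE(5) PiE_iff extensional_def fun_eq_iff)
    show "\<exists>g\<in>\<Pi>\<^sub>E i\<in>I. carrier (M i). g \<oplus>\<^bsub>direct_sum I M\<^esub> f = \<zero>\<^bsub>direct_sum I M\<^esub>"
      using f ag
      by (intro bexI[of _ "\<lambda>i\<in>I. \<ominus>\<^bsub>M i\<^esub> f i"])
        (auto simp: direct_sum_def PiE_iff abelian_group.l_neg abelian_group.a_inv_closed intro!: restrict_ext)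
  qed (use ag in \<open>auto simp: direct_sum_def abelian_groupE\<close>)
  note lm = left_module.smult_closed[OF M] left_module.smult_l_distr[OF M] left_module.smult_r_distr[OF M]
    left_module.smult_assoc[OF M] left_module.smult_one[OF M]
  show ?thesis
  proof (intro left_module.intro left_module_axioms.intro R ab, unfold carr)
  qed (auto simp: direct_sum_def PiE_iff lm ring.ring_simprules(1)[OF R] extensional_def fun_eq_iff)
qed

text \<open>The module axioms for \<open>T\<close> are not assumed: they are transported along \<open>F\<close>.  For the tensor product
  this avoids proving that \<open>\<Delta>\<close> is multiplicative.\<close>

lemma left_module_isomorphicI:
  assumes D: "left_module R D"
    and F: "bij_betw F (carrier D) (carrier T)"
    and add: "\<And>v w. v \<in> carrier D \<Longrightarrow> w \<in> carrier D \<Longrightarrow> F (v \<oplus>\<^bsub>D\<^esub> w) = F v \<oplus>\<^bsub>T\<^esub> F w"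
    and zero: "F \<zero>\<^bsub>D\<^esub> = \<zero>\<^bsub>T\<^esub>"
    and smult: "\<And>r v. r \<in> carrier R \<Longrightarrow> v \<in> carrier D \<Longrightarrow> F (r \<odot>\<^bsub>D\<^esub> v) = r \<odot>\<^bsub>T\<^esub> F v"
  shows "left_module_isomorphic R T D"
proof -
  interpret D: left_module R D by (rule D)
  have carr: "carrier T = F ` carrier D" using F by (simp add: bij_betw_def)
  note simps = add[symmetric] smult[symmetric] D.smult_closed D.smult_l_distr D.smult_r_distr D.smult_assoc D.smult_one
  have "abelian_group T"
  proof (rule abelian_groupI)
    fix x assume "x \<in> carrier T"
    then obtain v where v: "v \<in> carrier D" "x = F v" using carr by auto
    then have "F (\<ominus>\<^bsub>D\<^esub> v) \<oplus>\<^bsub>T\<^esub> x = \<zero>\<^bsub>T\<^esub>" using D.M.l_neg by (simp add: zero flip: add)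
    then show "\<exists>y\<in>carrier T. y \<oplus>\<^bsub>T\<^esub> x = \<zero>\<^bsub>T\<^esub>" using v carr by auto
  qed (auto simp: carr D.M.a_ac simp flip: add zero)
  then have T: "left_module R T"
    by (intro left_module.intro left_module_axioms.intro D.R.ring_axioms) (auto simp: carr simps)
  define f where "f = inv_into (carrier D) F"
  have f: "f (F v) = v" if "v \<in> carrier D" for v
    using F that by (simp add: f_def bij_betw_def)
  have "f \<in> left_module_hom R T D"
    by (auto simp: left_module_hom_def carr f simps)
  moreover have "bij_betw f (carrier T) (carrier D)"
    unfolding f_def by (rule bij_betw_inv_into[OF F])
  ultimately show ?thesis using T D by (auto simp: left_module_isomorphic_def)
qed

lemma inv_char:
  fixes G :: "('g, 'm) monoid_scheme" and \<chi> :: "'g \<Rightarrow> 'k::field"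
  assumes "group G" "\<chi> \<in> carrier (char_group G)" "g \<in> carrier G"
  shows "(inv\<^bsub>char_group G\<^esub> \<chi>) g = inverse (\<chi> g)"
proof -
  interpret C: comm_group "char_group G :: ('g \<Rightarrow> 'k) monoid" by (rule comm_group_char_group[OF assms(1)])
  have "(inv\<^bsub>char_group G\<^esub> \<chi> \<otimes>\<^bsub>char_group G\<^esub> \<chi>) g = \<one>\<^bsub>char_group G\<^esub> g"
    using C.l_inv[OF assms(2)] by simp
  then show ?thesis using assms(3) character_simps(2)[OF assms(1,2,3)]
    by (simp add: char_group_def field_simps)
qed

lemma char_pow_mult:
  assumes G: "group G" and c: "\<chi> \<in> carrier (char_group G)" and g: "g \<in> carrier G"
  shows "(\<chi> [^]\<^bsub>char_group G\<^esub> (n::nat) \<otimes>\<^bsub>char_group G\<^esub> \<rho> \<otimes>\<^bsub>char_group G\<^esub> \<sigma>) g = \<chi> g ^ n * \<rho> g * (\<sigma> g :: 'k::field)"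
proof -
  have "(\<chi> [^]\<^bsub>char_group G\<^esub> n) g = \<chi> g ^ n"
    using g by (induction n) (simp_all add: nat_pow_def char_group_def)
  then show ?thesis using g by (simp add: char_group_def)
qed

section \<open>The algebra and its modules \<open>V\<close>\<close>

locale ore_hopf = G: group G for G :: "('g, 'm) monoid_scheme" +
  fixes \<chi> \<psi> :: "'g \<Rightarrow> 'k::field" and a :: 'g
  assumes chi: "\<chi> \<in> carrier (char_group G)"
    and psi: "\<psi> \<in> carrier (char_group G)"
    and psi_chi: "\<And>g. g \<in> carrier G \<Longrightarrow> \<psi> g * \<chi> g = 1"
    and a: "a \<in> carrier G"
begin

abbreviation "A \<equiv> ore_algebra G \<psi>"
abbreviation "H \<equiv> hopf_ore G \<psi> a"
abbreviation "HB \<equiv> carrier G \<times> (UNIV :: nat set)"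

lemmas char_mult = character_simps(1)[OF G.group_axioms]
  and char_one = character_simps(3)[OF G.group_axioms _ G.one_closed G.one_closed]

lemma kspace_A: "kspace A HB"
  by (simp add: kspace_def ore_algebra_def)

lemma omul_fspace: "p \<in> fspace HB \<Longrightarrow> q \<in> fspace HB \<Longrightarrow> omul G \<psi> p q \<in> fspace HB"
  unfolding omul_def by (intro lext_fspace[where B = HB]) auto

lemma H_simps [simp]:
  "carrier H = fspace HB" "p \<otimes>\<^bsub>H\<^esub> q = omul G \<psi> p q" "\<one>\<^bsub>H\<^esub> = bvec (\<one>\<^bsub>G\<^esub>, 0)" "\<zero>\<^bsub>H\<^esub> = 0"
  "p \<oplus>\<^bsub>H\<^esub> q = p + q" "c \<odot>\<^bsub>H\<^esub> p = fscale c p"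
  by (simp_all add: hopf_ore_def Let_def ore_algebra_mult) (simp_all add: ore_algebra_def)

text \<open>On g x^i, h x^j, l x^n both sides carry the coefficient \<psi>(h)^i \<psi>(l)^(i+j),
  since \<psi> is multiplicative.\<close>

lemma omul_assoc:
  assumes "p \<in> fspace HB" "q \<in> fspace HB" "r \<in> fspace HB"
  shows "omul G \<psi> (omul G \<psi> p q) r = omul G \<psi> p (omul G \<psi> q r)"
proof (rule bilin_eqI[OF _ _ _ _ assms(1,2)], goal_cases)
  case (5 b c)
  show ?case
  proof (rule lin_eqI[OF _ _ assms(3)])
    fix d assume "d \<in> HB"
    with 5 show "omul G \<psi> (omul G \<psi> (bvec b) (bvec c)) (bvec d) = omul G \<psi> (bvec b) (omul G \<psi> (bvec c) (bvec d))"
      by (cases b; cases c; cases d)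
        (auto simp: G.m_assoc char_mult[OF psi] power_add power_mult_distrib add.assoc mult_ac)
  qed (auto intro: lin_omul lin_compose[OF lin_omul(2)])
qed (auto intro: lin_omul lin_compose[OF lin_omul(1)] lin_compose[OF lin_omul(2)])

lemma omul_one:
  assumes "p \<in> fspace HB"
  shows "omul G \<psi> (bvec (\<one>\<^bsub>G\<^esub>, 0)) p = p" "omul G \<psi> p (bvec (\<one>\<^bsub>G\<^esub>, 0)) = p"
  by (rule lin_eqI[OF _ lin_id assms]; auto intro: lin_omul simp: char_one[OF psi])+

lemma ring_H: "ring H"
proof (rule ringI)
  show "abelian_group H"
    by (rule abelian_groupI) (auto simp: add_ac intro: bexI[of _ "- x" for x])
  show "monoid H"
    by (rule monoidI) (auto simp: omul_fspace omul_assoc omul_one)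
qed (auto simp: lin_add[OF lin_omul(1)] lin_add[OF lin_omul(2)])

abbreviation "V t \<rho> \<equiv> V_module \<chi> t \<rho>"

lemma V_simps [simp]: "carrier (V t \<rho>) = fspace {..<t}" "v \<oplus>\<^bsub>V t \<rho>\<^esub> w = v + w" "\<zero>\<^bsub>V t \<rho>\<^esub> = 0"
  by (simp_all add: V_module_def)

lemma vact_one:
  assumes "\<rho> \<in> carrier (char_group G)" "v \<in> fspace {..<t}"
  shows "vact \<chi> t \<rho> (bvec (\<one>\<^bsub>G\<^esub>, 0)) v = v"
  by (rule lin_eqI[OF _ lin_id assms(2)]) (auto intro: lin_vact simp: char_one[OF chi] char_one[OF assms(1)])

lemma vact_assoc:
  assumes \<rho>: "\<rho> \<in> carrier (char_group G)" and p: "p \<in> fspace HB" and q: "q \<in> fspace HB" and v: "v \<in> fspace {..<t}"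
  shows "vact \<chi> t \<rho> (omul G \<psi> p q) v = vact \<chi> t \<rho> p (vact \<chi> t \<rho> q v)"
proof (rule bilin_eqI[OF _ _ _ _ p q], goal_cases)
  case (5 b c)
  show ?case
  proof (rule lin_eqI[OF _ _ v])
    fix j assume "j \<in> {..<t}"
    obtain g i h l where bc: "b = (g, i)" "c = (h, l)" "g \<in> carrier G" "h \<in> carrier G" using 5 by auto
    \<comment> \<open>Moving x^i past h costs \<psi>(h)^i, which cancels a surplus \<chi>(h)^i: on
      the right h acts in degree \<open>l + j\<close>, on the left in degree
      \<open>i + l + j\<close>.\<close>
    have "\<psi> h ^ i * \<chi> h ^ i = 1"
      using psi_chi[OF bc(4)] by (simp flip: power_mult_distrib)
    then have "\<psi> h ^ i * \<chi> h ^ (i + l + j) = \<chi> h ^ (l + j)"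
      by (simp add: power_add flip: mult.assoc)
    moreover have "\<psi> h ^ i * \<chi> (g \<otimes>\<^bsub>G\<^esub> h) ^ (i + l + j) * \<rho> (g \<otimes>\<^bsub>G\<^esub> h) =
      (\<psi> h ^ i * \<chi> h ^ (i + l + j)) * \<rho> h * \<chi> g ^ (i + l + j) * \<rho> g"
      using bc by (simp add: char_mult[OF chi] char_mult[OF \<rho>] power_mult_distrib mult_ac)
    ultimately have eq: "\<psi> h ^ i * \<chi> (g \<otimes>\<^bsub>G\<^esub> h) ^ (i + l + j) * \<rho> (g \<otimes>\<^bsub>G\<^esub> h) =
      \<chi> h ^ (l + j) * \<rho> h * \<chi> g ^ (i + l + j) * \<rho> g" by simp
    show "vact \<chi> t \<rho> (omul G \<psi> (bvec b) (bvec c)) (bvec j) = vact \<chi> t \<rho> (bvec b) (vact \<chi> t \<rho> (bvec c) (bvec j))"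
      using bc(3,4) eq by (simp add: bc(1,2) add.assoc)
  qed (auto intro: lin_vact lin_compose[OF lin_vact(2)])
qed (auto intro: lin_vact lin_compose[OF lin_vact(1)] lin_compose[OF lin_vact(2)] lin_omul)

lemma left_module_V:
  assumes \<rho>: "\<rho> \<in> carrier (char_group G)"
  shows "left_module H (V t \<rho>)"
proof (intro left_module.intro left_module_axioms.intro ring_H)
  show "abelian_group (V t \<rho>)"
    by (rule abelian_groupI) (auto simp: add_ac intro: bexI[of _ "- x" for x])
qed (auto simp: V_module_smult vact_fspace lin_add[OF lin_vact(1)] lin_add[OF lin_vact(2)] vact_assoc[OF \<rho>] vact_one[OF \<rho>])

end

section \<open>The comultiplication on representatives\<close>

context ore_hopf
begin

abbreviation "fmul \<equiv> formal_product (omul G \<psi>) (omul G \<psi>)"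

text \<open>\<open>dx\<close>, \<open>dpow n\<close> and \<open>dbasis (g, n)\<close> represent the classes \<open>\<Delta>(x)\<close>, \<open>\<Delta>(x)\<^sup>n\<close> and
  \<open>\<Delta>(g x\<^sup>n)\<close> in \<open>H \<otimes> H\<close>.\<close>

definition "dx = bvec (bvec (\<one>\<^bsub>G\<^esub>, 1), bvec (a, 0)) + bvec (bvec (\<one>\<^bsub>G\<^esub>, 0), bvec (\<one>\<^bsub>G\<^esub>, 1))"

primrec dpow where
  "dpow 0 = bvec (bvec (\<one>\<^bsub>G\<^esub>, 0), bvec (\<one>\<^bsub>G\<^esub>, 0))"
| "dpow (Suc n) = fmul (dpow n) dx"

definition "dbasis b = fmul (bvec (bvec (fst b, 0), bvec (fst b, 0))) (dpow (snd b))"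

lemma dx_fspace: "dx \<in> fspace2 HB HB"
  unfolding dx_def using a by (intro fspace_add fspace_single) auto

lemma fmul_fspace: "p \<in> fspace2 HB HB \<Longrightarrow> q \<in> fspace2 HB HB \<Longrightarrow> fmul p q \<in> fspace2 HB HB"
  by (rule formal_product_fspace) (auto intro: omul_fspace)

lemma dpow_fspace: "dpow n \<in> fspace2 HB HB"
  by (induction n) (auto intro!: fmul_fspace dx_fspace fspace_single)

lemma dbasis_fspace: "b \<in> HB \<Longrightarrow> dbasis b \<in> fspace2 HB HB"
  unfolding dbasis_def by (intro fmul_fspace dpow_fspace fspace_single) auto

lemma tensor_mult_A:
  "p \<in> fspace2 HB HB \<Longrightarrow> q \<in> fspace2 HB HB \<Longrightarrow>
    tensor_class A A p \<otimes>\<^bsub>tensor A A\<^esub> tensor_class A A q = tensor_class A A (fmul p q)"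
  by (rule tensor_mult[OF kspace_A kspace_A]) (auto simp: ore_algebra_mult omul_fspace intro: lin_omul)

lemma tensor_pow_A: "tensor_class A A dx [^]\<^bsub>tensor A A\<^esub> n = tensor_class A A (dpow n)"
proof (induction n)
  case 0
  show ?case by (simp add: nat_pow_def tensor_def pure_tensor_def ore_algebra_def)
next
  case (Suc n)
  then show ?case using tensor_mult_A[OF dpow_fspace dx_fspace] by (simp add: nat_pow_def)
qed

text \<open>The sum, products and powers of cosets that define \<Delta> are carried out on
  representatives, which yields one that is linear in \<open>p\<close>.\<close>

lemma comult_H:
  assumes p: "p \<in> fspace HB"
  shows "comult H p = tensor_class A A (lext dbasis p)"
proof -
  have keys: "b \<in> HB" if "b \<in> Poly_Mapping.keys p" for b
    using p that by (auto simp: fspace_def)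
  have one: "\<one>\<^bsub>A\<^esub> = bvec (\<one>\<^bsub>G\<^esub>, 0)" by (simp add: ore_algebra_def)
  have dx: "pure_tensor A A (bvec (\<one>\<^bsub>G\<^esub>, 1)) (bvec (a, 0)) \<oplus>\<^bsub>tensor A A\<^esub>
      pure_tensor A A (bvec (\<one>\<^bsub>G\<^esub>, 0)) (bvec (\<one>\<^bsub>G\<^esub>, 1)) = tensor_class A A dx"
    by (simp add: pure_tensor_def tensor_add dx_def)
  have summand: "Poly_Mapping.lookup p b \<odot>\<^bsub>tensor A A\<^esub>
       (pure_tensor A A (bvec (fst b, 0)) (bvec (fst b, 0)) \<otimes>\<^bsub>tensor A A\<^esub>
         tensor_class A A dx [^]\<^bsub>tensor A A\<^esub> snd b) =
      tensor_class A A (fscale (Poly_Mapping.lookup p b) (dbasis b))"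
    if "b \<in> Poly_Mapping.keys p" for b
    unfolding tensor_pow_A pure_tensor_def dbasis_def
    using keys[OF that] by (subst tensor_mult_A) (auto intro!: dpow_fspace fspace_single simp: tensor_smult)
  have "comult H p = (\<Oplus>\<^bsub>tensor A A\<^esub>b\<in>Poly_Mapping.keys p. Poly_Mapping.lookup p b \<odot>\<^bsub>tensor A A\<^esub>
       (pure_tensor A A (bvec (fst b, 0)) (bvec (fst b, 0)) \<otimes>\<^bsub>tensor A A\<^esub>
         tensor_class A A dx [^]\<^bsub>tensor A A\<^esub> snd b))"
    by (simp add: hopf_ore_def Let_def one flip: dx)
  also have "\<dots> = (\<Oplus>\<^bsub>tensor A A\<^esub>b\<in>Poly_Mapping.keys p.
      tensor_class A A (fscale (Poly_Mapping.lookup p b) (dbasis b)))"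
  proof -
    have "fscale (Poly_Mapping.lookup p b) (dbasis b) \<in> fspace2 HB HB" if "b \<in> Poly_Mapping.keys p" for b
      using that by (intro fspace_scale dbasis_fspace keys)
    note class_carrier = imageI[OF this, of _ "tensor_class A A"]
    interpret T: abelian_monoid "tensor A A" by (rule tensor_abelian_monoid[OF kspace_A kspace_A])
    show ?thesis
      using class_carrier by (intro T.finsum_cong') (auto simp: summand tensor_carrier[OF kspace_A kspace_A])
  qed
  also have "\<dots> = tensor_class A A (lext dbasis p)"
    unfolding lext_def
    by (intro tensor_finsum[OF kspace_A kspace_A] finite_keys fspace_scale dbasis_fspace keys)
  finally show ?thesis .
qed

end

text \<open>The operators on the coordinate space of \<open>V\<^sub>s(\<rho>) \<otimes> V\<^sub>t(\<sigma>)\<close> by which \<open>x\<close> and \<open>g\<close> act.\<close>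

definition raise :: "'k::field \<Rightarrow> 'k \<Rightarrow> nat \<Rightarrow> nat \<Rightarrow> (nat \<times> nat \<Rightarrow>\<^sub>0 'k) \<Rightarrow> (nat \<times> nat \<Rightarrow>\<^sub>0 'k)"
  where "raise c e s t = lext (\<lambda>(i, j).
    (if i + 1 < s then Poly_Mapping.single (i + 1, j) (c ^ j * e) else 0) +
    (if j + 1 < t then bvec (i, j + 1) else 0))"

definition diag :: "'k::field \<Rightarrow> 'k \<Rightarrow> (nat \<times> nat \<Rightarrow>\<^sub>0 'k) \<Rightarrow> (nat \<times> nat \<Rightarrow>\<^sub>0 'k)"
  where "diag c e = lext (\<lambda>(i, j). Poly_Mapping.single (i, j) (c ^ (i + j) * e))"

lemma lin_raise: "lin (raise c e s t)"
  by (simp add: raise_def)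

lemma lin_diag: "lin (diag c e)"
  by (simp add: diag_def)

section \<open>The action on the tensor product in coordinates\<close>

locale ore_tensor = ore_hopf +
  fixes \<rho> \<sigma> :: "'a \<Rightarrow> 'c::field" and s t :: nat
  assumes rho: "\<rho> \<in> carrier (char_group G)" and sigma: "\<sigma> \<in> carrier (char_group G)"
begin

abbreviation "VS \<equiv> restrict_scalars H (V s \<rho>)"
abbreviation "VT \<equiv> restrict_scalars H (V t \<sigma>)"
abbreviation "T \<equiv> tensor_module H (V s \<rho>) (V t \<sigma>)"
abbreviation "tact \<equiv> formal_product (vact \<chi> s \<rho>) (vact \<chi> t \<sigma>)"
abbreviation X_op where "X_op \<equiv> raise (\<chi> a) (\<sigma> a) s t"
abbreviation G_op where "G_op g \<equiv> diag (\<chi> g) (\<rho> g * \<sigma> g)"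

lemma kspace_restrict: "\<tau> \<in> carrier (char_group G) \<Longrightarrow> kspace (restrict_scalars H (V n \<tau>)) {..<n}"
  unfolding kspace_def restrict_scalars_def
  by (auto simp: V_module_smult fun_eq_iff lin_scale[OF lin_vact(1)] vact_one simp del: fscale_single)

lemmas k = kspace_restrict[OF rho, of s] kspace_restrict[OF sigma, of t]

abbreviation "FV \<equiv> fspace2 {..<s} {..<t}"

lemma tact_fspace: "d \<in> fspace2 HB HB \<Longrightarrow> p \<in> FV \<Longrightarrow> tact d p \<in> FV"
  by (rule formal_product_fspace) (auto intro: vact_fspace)

text \<open>Both factors are modules, so formal sums act multiplicatively; hence powers of
  \<Delta>(x) act by powers of one operator.\<close>

lemma tact_fmul: "d \<in> fspace2 HB HB \<Longrightarrow> e \<in> fspace2 HB HB \<Longrightarrow> p \<in> FV \<Longrightarrow>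
  tact (fmul d e) p = tact d (tact e p)"
  by (rule formal_product_assoc) (auto intro: vact_assoc rho sigma)

text \<open>A pair \<open>(u, u')\<close> acts factorwise and \<open>tens\<close> is bilinear, so
  the comparison with \<open>F\<close> reduces to basis vectors.\<close>

lemma coord_tact_bvec:
  assumes "p \<in> FV" "lin F"
    and "\<And>i j. i < s \<Longrightarrow> j < t \<Longrightarrow> tens (vact \<chi> s \<rho> u (bvec i)) (vact \<chi> t \<sigma> u' (bvec j)) = F (bvec (i, j))"
  shows "coord (tact (bvec (u, u')) p) = F (coord p)"
proof (rule lin_eqI[OF _ _ assms(1)], goal_cases)
  case (3 b)
  obtain v w where b: "b = (v, w)" "v \<in> fspace {..<s}" "w \<in> fspace {..<t}" using 3 by auto
  have "tens (vact \<chi> s \<rho> u v) (vact \<chi> t \<sigma> u' w) = F (tens v w)"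
    by (rule bilin_eqI[OF _ _ _ _ b(2,3)])
      (auto intro: lin_compose[OF lin_tens(1)] lin_compose[OF lin_tens(2)] lin_compose[OF assms(2)] lin_vact lin_tens simp: assms(3))
  then show ?case by (simp add: b(1))
qed (auto intro: lin_compose[OF lin_coord] lin_compose[OF assms(2)] lin_formal_product lin_coord)

text \<open>The terms x \<otimes> a and 1 \<otimes> x of \<Delta>(x) give the two terms of
  \<open>raise\<close>; the scalar \<chi>(a)^j \<sigma>(a) is the action of a on the second
  factor.\<close>

lemma coord_tact_dx:
  assumes p: "p \<in> FV" shows "coord (tact dx p) = X_op (coord p)"
proof -
  let ?X1 = "lext (\<lambda>(i, j). if i + 1 < s then Poly_Mapping.single (i + 1, j) (\<chi> a ^ j * \<sigma> a) else 0)"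
  let ?X2 = "lext (\<lambda>(i, j). if j + 1 < t then bvec (i, j + 1) else 0)"
  have "coord (tact dx p) = ?X1 (coord p) + ?X2 (coord p)"
    unfolding dx_def lin_add[OF lin_formal_product(1)] lin_add[OF lin_coord]
    by (intro arg_cong2[where f = "(+)"] coord_tact_bvec[OF p])
      (auto simp: char_one chi rho sigma)
  also have "\<dots> = X_op (coord p)"
    unfolding raise_def lext_def by (simp add: case_prod_unfold fs.scale_right_distrib sum.distrib)
  finally show ?thesis .
qed

lemma coord_tact_grp:
  assumes p: "p \<in> FV" shows "coord (tact (bvec (bvec (g, 0), bvec (g, 0))) p) = G_op g (coord p)"
  by (rule coord_tact_bvec[OF p lin_diag]) (auto simp: diag_def power_add mult_ac)

lemma coord_tact_dpow:
  assumes p: "p \<in> FV" shows "coord (tact (dpow n) p) = (X_op ^^ n) (coord p)"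
  using p
proof (induction n arbitrary: p)
  case 0
  then show ?case using coord_tact_grp[OF 0, of "\<one>\<^bsub>G\<^esub>"]
    by (simp add: char_one chi rho sigma diag_def case_prod_unfold)
next
  case (Suc n)
  have "coord (tact (dpow (Suc n)) p) = coord (tact (dpow n) (tact dx p))"
    by (simp add: tact_fmul dpow_fspace dx_fspace Suc.prems)
  also have "\<dots> = (X_op ^^ n) (X_op (coord p))"
    by (simp add: Suc tact_fspace dx_fspace coord_tact_dx)
  finally show ?case by (simp add: funpow_swap1)
qed

lemma coord_tact:
  assumes h: "h \<in> fspace HB" and p: "p \<in> FV"
  shows "coord (tact (lext dbasis h) p) = lext (\<lambda>b. G_op (fst b) ((X_op ^^ snd b) (coord p))) h"
proof (rule lin_eqI[OF _ _ h])
  fix b assume "b \<in> HB"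
  then show "coord (tact (lext dbasis (bvec b)) p) = lext (\<lambda>b. G_op (fst b) ((X_op ^^ snd b) (coord p))) (bvec b)"
    by (auto simp: dbasis_def tact_fmul dpow_fspace p coord_tact_grp tact_fspace coord_tact_dpow)
qed (auto intro: lin_compose[OF lin_coord lin_compose[OF lin_formal_product(1) lin_lext]])

lemma T_carrier: "carrier T = tensor_class VS VT ` FV"
  by (simp add: tensor_module_def Let_def tensor_carrier[OF k])

lemma T_add: "tensor_class VS VT p \<oplus>\<^bsub>T\<^esub> tensor_class VS VT q = tensor_class VS VT (p + q)"
  using tensor_add[of VS VT p q] by (simp add: tensor_module_def Let_def)

lemma T_zero: "\<zero>\<^bsub>T\<^esub> = tensor_class VS VT 0"
  by (simp add: tensor_module_def Let_def tensor_def)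

lemma T_smult:
  assumes h: "h \<in> fspace HB" and p: "p \<in> FV"
  shows "h \<odot>\<^bsub>T\<^esub> tensor_class VS VT p = tensor_class VS VT (tact (lext dbasis h) p)"
proof -
  let ?d = "lext dbasis h"
  have d: "?d \<in> fspace2 HB HB" by (rule lext_fspace[OF h dbasis_fspace])
  have "tensor_class VS VT (tact d' p') = tensor_class VS VT (tact ?d p)"
    if d': "d' - ?d \<in> rspan A A" and p': "p' - p \<in> rspan VS VT" for d' p'
  proof -
    have p'F: "p' \<in> FV"
      using fspace_add[of "p' - p", OF _ p] rspan_subset[OF k] p' by auto
    have "tact (d' - ?d) p' \<in> rspan VS VT"
      by (rule formal_product_relations_left[OF kspace_A kspace_A k _ _ _ _ d' p'F])
        (auto intro: lin_vact vact_fspace)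
    then have 1: "tensor_class VS VT (tact d' p') = tensor_class VS VT (tact ?d p')"
      by (simp add: tensor_class_eq_iff lin_diff[OF lin_formal_product(1)])
    \<comment> \<open>A change of the vector is handled in coordinates: by \<open>coord_tact\<close>
      the result depends on \<open>coord p\<close> only.\<close>
    have "coord p' = coord p"
      using p' tensor_class_eq_iff_coord[OF k p'F p] by (simp add: tensor_class_eq_iff)
    then have "coord (tact ?d p') = coord (tact ?d p)"
      using coord_tact[OF h] p p'F by simp
    then have "tensor_class VS VT (tact ?d p') = tensor_class VS VT (tact ?d p)"
      by (simp add: tensor_class_eq_iff_coord[OF k] tact_fspace d p p'F)
    with 1 show ?thesis by simp
  qed
  then have "(\<Union>d'\<in>tensor_class A A ?d. \<Union>p'\<in>tensor_class VS VT p. tensor_class VS VT (tact d' p')) =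
      tensor_class VS VT (tact ?d p)"
    by (intro UN_tensor_class)
  moreover have "module.smult (V n \<tau>) = vact \<chi> n \<tau>" for n \<tau>
    by (intro ext) (rule V_module_smult)
  ultimately show ?thesis
    by (simp add: tensor_module_def Let_def comult_H[OF h])
qed

end

section \<open>Strings of lowest weight vectors\<close>

text \<open>Here \<open>c\<close> is \<chi>(a) and \<open>e\<close> is \<sigma>(a), the scalars
  through which the algebra enters the operator X.\<close>

locale lefschetz =
  fixes c e :: "'k::field" and s t :: nat
  assumes c_nz: "c \<noteq> 0" and c_root: "\<And>n. n \<ge> 1 \<Longrightarrow> c ^ n \<noteq> 1" and e_nz: "e \<noteq> 0"
begin

text \<open>Writing \<open>YX - XY\<close> for \<open>lower\<close> and \<open>raise\<close> out on \<open>m\<^sub>p \<otimes> n\<^sub>r\<close>, the coefficients of \<open>Y\<close> are forced up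
  to scaling by asking for a scalar that depends on \<open>p + r\<close> only, and for \<open>phi n\<close> to vanish at \<open>0\<close>
  and \<open>n\<close> so that the truncations of \<open>X\<close> and \<open>Y\<close> do no harm.\<close>

definition phi :: "nat \<Rightarrow> nat \<Rightarrow> 'k"
  where "phi n p = (c ^ p - 1) * (1 - c ^ (n - p))"

definition lower :: "(nat \<times> nat \<Rightarrow>\<^sub>0 'k) \<Rightarrow> (nat \<times> nat \<Rightarrow>\<^sub>0 'k)"
  where "lower = lext (\<lambda>(p, r). Poly_Mapping.single (p - 1, r) (phi s p) +
    Poly_Mapping.single (p, r - 1) (e * c ^ (s - 1 - p) * phi t r))"

abbreviation "rai \<equiv> raise c e s t"

definition grid :: "nat \<Rightarrow> (nat \<times> nat) set"
  where "grid d = {(p, r). p < s \<and> r < t \<and> p + r = d}"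

lemma phi_0 [simp]: "phi n 0 = 0"
  by (simp add: phi_def)

lemma phi_self: "n \<le> p \<Longrightarrow> phi n p = 0"
  by (simp add: phi_def)

lemma phi_nonzero: "0 < p \<Longrightarrow> p < n \<Longrightarrow> phi n p \<noteq> 0"
  using c_root[of p] c_root[of "n - p"] by (auto simp: phi_def)

lemma phi_diff: "p < n \<Longrightarrow> phi n (p + 1) - phi n p = (c - 1) * (c ^ p - c ^ (n - 1 - p))"
proof -
  assume "p < n"
  then obtain k where "n = p + k + 1" using less_iff_Suc_add by auto
  then show ?thesis by (simp add: phi_def algebra_simps power_add)
qed

lemma lin_lower: "lin lower"
  by (simp add: lower_def)

text \<open>Off the diagonal YX and XY agree: at \<open>(p - 1, r + 1)\<close> at once, at
  \<open>(p + 1, r - 1)\<close> thanks to the factor \<open>c ^ (s - 1 - p)\<close> in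
  \<open>lower\<close>. On the diagonal, differences of \<open>phi\<close> remain, and their
  weighted sum depends on \<open>p + r\<close> only.\<close>

lemma lower_raise_bvec:
  assumes p: "p < s" and r: "r < t"
  shows "lower (rai (bvec (p, r))) = rai (lower (bvec (p, r))) +
    fscale (e * (c - 1) * (c ^ (p + r) - c ^ (s + t - 2 - (p + r)))) (bvec (p, r))"
proof -
  let ?S = "Poly_Mapping.single"
  \<comment> \<open>The diagonal terms carry no conditions at the ends of the ranges, because
    \<open>phi\<close> vanishes there.\<close>
  let ?u = "?S (p, r) (c ^ r * e * phi s (p + 1)) + ?S (p, r) (e * c ^ (s - 1 - p) * phi t (r + 1))
    + (if r = 0 \<or> s \<le> p + 1 then 0 else ?S (p + 1, r - 1) (c ^ r * e * (e * c ^ (s - 1 - (p + 1)) * phi t r)))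
    + (if p = 0 \<or> t \<le> r + 1 then 0 else ?S (p - 1, r + 1) (phi s p))"
  let ?v = "?S (p, r) (c ^ r * e * phi s p) + ?S (p, r) (e * c ^ (s - 1 - p) * phi t r)
    + (if r = 0 \<or> s \<le> p + 1 then 0 else ?S (p + 1, r - 1) (c ^ (r - 1) * e * (e * c ^ (s - 1 - p) * phi t r)))
    + (if p = 0 \<or> t \<le> r + 1 then 0 else ?S (p - 1, r + 1) (phi s p))"
  have 1: "lower (rai (bvec (p, r))) = ?u"
    using p r by (auto simp: raise_def lower_def lext_add phi_self fs.scale_right_distrib mult.assoc add_ac)
  have 2: "rai (lower (bvec (p, r))) = ?v"
    using p r by (cases p; cases r) (auto simp: raise_def lower_def lext_add fs.scale_right_distrib phi_self add_ac mult_ac)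
  have "c ^ r * c ^ (s - 1 - (p + 1)) = c ^ (r - 1) * c ^ (s - 1 - p)" if "r \<noteq> 0" "p + 1 < s"
  proof -
    have "r + (s - 1 - (p + 1)) = (r - 1) + (s - 1 - p)" using that by simp
    then show ?thesis unfolding power_add[symmetric] by simp
  qed
  then have 3: "?u = ?v + (?S (p, r) (c ^ r * e * (phi s (p + 1) - phi s p)) + ?S (p, r) (e * c ^ (s - 1 - p) * (phi t (r + 1) - phi t r)))"
    by (auto simp: single_diff algebra_simps)
  \<comment> \<open>The mixed terms \<open>c ^ r * c ^ (s - 1 - p)\<close> cancel.\<close>
  have sum: "c ^ r * (c ^ p - c ^ (s - 1 - p)) + c ^ (s - 1 - p) * (c ^ r - c ^ (t - 1 - r)) = c ^ (p + r) - c ^ (s + t - 2 - (p + r))"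
  proof -
    have "s + t - 2 - (p + r) = (s - 1 - p) + (t - 1 - r)" using p r by simp
    then show ?thesis by (simp add: algebra_simps power_add)
  qed
  have dist: "c ^ r * e * ((c - 1) * x) + e * y * ((c - 1) * z) = e * (c - 1) * (c ^ r * x + y * z)" for x y z
    by (simp add: algebra_simps)
  have "c ^ r * e * (phi s (p + 1) - phi s p) + e * c ^ (s - 1 - p) * (phi t (r + 1) - phi t r)
      = e * (c - 1) * (c ^ (p + r) - c ^ (s + t - 2 - (p + r)))"
    unfolding phi_diff[OF p] phi_diff[OF r] dist sum ..
  then have "?S (p, r) (c ^ r * e * (phi s (p + 1) - phi s p)) + ?S (p, r) (e * c ^ (s - 1 - p) * (phi t (r + 1) - phi t r))
      = fscale (e * (c - 1) * (c ^ (p + r) - c ^ (s + t - 2 - (p + r)))) (bvec (p, r))"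
    unfolding single_add[symmetric] fscale_single mult_1_right by (rule arg_cong)
  then show ?thesis by (simp only: 1 2 3)
qed

lemma raise_grid: "u \<in> fspace (grid d) \<Longrightarrow> rai u \<in> fspace (grid (Suc d))"
  unfolding raise_def by (rule lext_fspace) (auto simp: grid_def intro!: fspace_add)

lemma raise_pow_grid: "u \<in> fspace (grid d) \<Longrightarrow> (rai ^^ n) u \<in> fspace (grid (d + n))"
  by (induction n) (auto intro: raise_grid)

lemma lower_raise:
  assumes "u \<in> fspace (grid d)"
  shows "lower (rai u) = rai (lower u) + fscale (e * (c - 1) * (c ^ d - c ^ (s + t - 2 - d))) u"
  by (rule lin_eqI[OF _ _ assms])
    (auto simp: grid_def lower_raise_bvec simp del: fscale_single
      intro: lin_compose[OF lin_lower lin_raise] lin_compose[OF lin_raise lin_lower] lin_fun_add lin_fun_scale lin_id)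

text \<open>Only \<open>(p + 1, r)\<close> and \<open>(p, r + 1)\<close> contribute at
  \<open>(p, r)\<close>; where \<open>p - 1\<close> or \<open>r - 1\<close> truncates, the
  coefficient is 0.\<close>

lemma lookup_lower:
  "Poly_Mapping.lookup (lower u) (p, r) = phi s (p + 1) * Poly_Mapping.lookup u (p + 1, r) +
    e * c ^ (s - 1 - p) * phi t (r + 1) * Poly_Mapping.lookup u (p, r + 1)"
proof -
  have 1: "Poly_Mapping.lookup (case b of (p, r) \<Rightarrow> Poly_Mapping.single (p - 1, r) (phi s p) +
      Poly_Mapping.single (p, r - 1) (e * c ^ (s - 1 - p) * phi t r)) (p, r) =
    (if b = (p + 1, r) then phi s (p + 1) else 0) + (if b = (p, r + 1) then e * c ^ (s - 1 - p) * phi t (r + 1) else 0)"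
    for b
    by (cases b; cases "fst b"; cases "snd b") (auto simp: lookup_add lookup_single when_def)
  show ?thesis
    unfolding lower_def lext_def lookup_sum lookup_fscale 1 distrib_left sum.distrib
    by (simp add: if_distrib[of "(*) _"] in_keys_iff cong: if_cong)
qed

text \<open>In degree \<open>d \<ge> t\<close> no basis pair has \<open>p = 0\<close>. Induction on
  \<open>p\<close> clears the rest: the equation at \<open>(p, r)\<close> determines the coefficient
  at \<open>(p + 1, r)\<close> from the one at \<open>(p, r + 1)\<close>, since
  \<open>phi s (p + 1)\<close> is nonzero.\<close>

lemma lower_inj:
  assumes u: "u \<in> fspace (grid d)" and d: "t \<le> d" and l: "lower u = 0"
  shows "u = 0"
proof -
  have "Poly_Mapping.lookup u (p, r) = 0" for p r
  proof (induction p arbitrary: r)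
    case 0
    have "(0, r) \<notin> grid d" using d by (auto simp: grid_def)
    then show ?case using u by (simp add: fspace_iff)
  next
    case (Suc p)
    show ?case
    proof (cases "Suc p < s")
      case True
      have "Poly_Mapping.lookup (lower u) (p, r) = 0" by (simp add: l)
      then show ?thesis using True Suc[of "Suc r"] phi_nonzero[of "Suc p" s] by (simp add: lookup_lower)
    next
      case False
      then have "(Suc p, r) \<notin> grid d" by (auto simp: grid_def)
      then show ?thesis using u by (simp add: fspace_iff)
    qed
  qed
  then show ?thesis by (intro poly_mapping_eqI) auto
qed

text \<open>Recursion forced by the vanishing of \<open>lower\<close> at
  \<open>(p, i - p - 1)\<close>; the denominator is nonzero for \<open>Suc p < s\<close>.\<close>

primrec wcoeff :: "nat \<Rightarrow> nat \<Rightarrow> 'k" where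
  "wcoeff i 0 = 1"
| "wcoeff i (Suc p) = - (e * c ^ (s - 1 - p) * phi t (i - p) / phi s (Suc p)) * wcoeff i p"

definition lowest :: "nat \<Rightarrow> (nat \<times> nat \<Rightarrow>\<^sub>0 'k)"
  where "lowest i = (\<Sum>p\<le>i. Poly_Mapping.single (p, i - p) (wcoeff i p))"

lemma lowest_grid: "i < min s t \<Longrightarrow> lowest i \<in> fspace (grid i)"
  unfolding lowest_def by (intro fspace_sum fspace_single) (auto simp: grid_def)

text \<open>This tells the strings apart: among the lowest weight vectors only
  \<open>lowest j\<close> meets the basis vector \<open>(0, j)\<close>.\<close>

lemma lookup_lowest: "Poly_Mapping.lookup (lowest i) (0, j) = (if i = j then 1 else 0)"
proof -
  have "Poly_Mapping.lookup (lowest i) (0, j) = (\<Sum>p\<le>i. if p = 0 then (if i = j then 1 else 0) else 0)"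
    unfolding lowest_def lookup_sum by (rule sum.cong) (auto simp: lookup_single when_def)
  then show ?thesis by simp
qed

lemma lower_lowest:
  assumes "i < min s t"
  shows "lower (lowest i) = 0"
proof (rule poly_mapping_eqI, clarify)
  fix p r
  have lk: "Poly_Mapping.lookup (lowest i) (p, r) = (if p + r = i then wcoeff i p else 0)" for p r
  proof -
    have "Poly_Mapping.lookup (lowest i) (p, r) = (\<Sum>p'\<le>i. if p' = p then (if p + r = i then wcoeff i p else 0) else 0)"
      unfolding lowest_def lookup_sum by (rule sum.cong) (auto simp: lookup_single when_def)
    then show ?thesis by (auto simp: sum.delta)
  qed
  show "Poly_Mapping.lookup (lower (lowest i)) (p, r) = Poly_Mapping.lookup 0 (p, r)"
    unfolding lookup_lower lk using assms phi_nonzero[of "Suc p" s] by auto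
qed

text \<open>For \<open>i + l < s + t\<close> this is the sum over \<open>j < l\<close> of the
  commutator scalars \<open>e * (c - 1) * (c ^ (i + j) - c ^ (s + t - 2 - (i + j)))\<close>,
  factored so that its zeros can be read off.\<close>

definition gam :: "nat \<Rightarrow> nat \<Rightarrow> 'k"
  where "gam i l = e * (c ^ l - 1) * (c ^ i - c ^ (s + t - 1 - i - l))"

text \<open>Moving \<open>lower\<close> past one more \<open>rai\<close> adds the commutator scalar
  of degree \<open>i + l\<close>; the induction starts from
  \<open>lower (lowest i) = 0\<close>.\<close>

lemma lower_string:
  assumes i: "i < min s t" and l: "i + l < s + t - 1"
  shows "lower ((rai ^^ Suc l) (lowest i)) = fscale (gam i (Suc l)) ((rai ^^ l) (lowest i))"
  using l
proof (induction l)
  case 0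
  have "s + t - Suc (Suc i) = s + t - 2 - i" by simp
  then show ?case
    using lower_raise[OF lowest_grid[OF i]] by (simp add: lower_lowest[OF i] lin_zero[OF lin_raise] gam_def)
next
  case (Suc l)
  \<comment> \<open>With \<open>K\<close> the truncated exponents of \<open>c\<close> become
    \<open>K\<close> and \<open>Suc K\<close>.\<close>
  define K where "K = s + t - 2 - i - Suc l"
  have K: "s + t - 1 - i - Suc l = Suc K" "s + t - 1 - i - Suc (Suc l) = K" "s + t - 2 - (i + Suc l) = K"
    using Suc.prems by (auto simp: K_def)
  have "gam i (Suc l) + e * (c - 1) * (c ^ (i + Suc l) - c ^ (s + t - 2 - (i + Suc l))) = gam i (Suc (Suc l))"
    unfolding gam_def K by (simp add: algebra_simps power_add)
  then show ?case
    using lower_raise[OF raise_pow_grid[OF lowest_grid[OF i]], of "Suc l"] Suc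
    by (simp add: lin_scale[OF lin_raise] flip: fs.scale_left_distrib)
qed

text \<open>At this length the two powers in \<open>gam\<close> agree, so \<open>lower\<close> kills
  the vector; its degree \<open>s + t - 1 - i\<close> is at least \<open>t\<close>, where
  \<open>lower\<close> is injective.\<close>

lemma string_end:
  assumes i: "i < min s t"
  shows "(rai ^^ (s + t - 1 - 2 * i)) (lowest i) = 0"
proof (rule lower_inj[OF raise_pow_grid[OF lowest_grid[OF i]]])
  define l where "l = s + t - 2 - 2 * i"
  have l: "s + t - 1 - 2 * i = Suc l" using i by (auto simp: l_def)
  have il: "i + l < s + t - 1" using i unfolding l_def by linarith
  have "s + t - 1 - i - Suc l = i" using i by (auto simp: l_def)
  then have "gam i (Suc l) = 0" by (simp add: gam_def)
  then show "lower ((rai ^^ (s + t - 1 - 2 * i)) (lowest i)) = 0"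
    unfolding l using lower_string[OF i, of l] il by (simp del: funpow.simps)
qed (use i in auto)

lemma string_end_ge:
  assumes i: "i < min s t" and n: "s + t - 1 - 2 * i \<le> n"
  shows "(rai ^^ n) (lowest i) = 0"
proof -
  obtain m where "n = m + (s + t - 1 - 2 * i)" using n by (metis add.commute le_iff_add)
  then show ?thesis by (simp only: funpow_add comp_def string_end[OF i] lin_zero[OF lin_funpow[OF lin_raise]])
qed

text \<open>Inside the string the two powers in \<open>gam\<close> differ by a factor
  \<open>c ^ n\<close> with \<open>n \<ge> 1\<close>, which is not 1; neither is
  \<open>c ^ l\<close>.\<close>

lemma gam_nonzero:
  assumes i: "i < min s t" and l: "1 \<le> l" "l < s + t - 1 - 2 * i"
  shows "gam i l \<noteq> 0"
proof -
  define n where "n = s + t - 1 - i - l - i"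
  have "s + t - 1 - i - l = i + n" using l by (auto simp: n_def)
  moreover have "n \<ge> 1" using l by (auto simp: n_def)
  moreover have "c ^ i \<noteq> c ^ (i + n)" using c_root[OF \<open>n \<ge> 1\<close>] c_nz by (simp add: power_add)
  ultimately show ?thesis using c_root[OF l(1)] e_nz by (auto simp: gam_def)
qed

text \<open>The factor is the product of \<open>gam i 1\<close> to \<open>gam i l\<close>, none of
  which vanishes.\<close>

lemma lower_pow_string:
  assumes i: "i < min s t" and l: "l < s + t - 1 - 2 * i"
  shows "\<exists>g. g \<noteq> 0 \<and> (lower ^^ l) ((rai ^^ l) (lowest i)) = fscale g (lowest i)"
  using l
proof (induction l)
  case 0
  show ?case by (auto intro!: exI[of _ 1])
next
  case (Suc l)
  then obtain g where g: "g \<noteq> 0" "(lower ^^ l) ((rai ^^ l) (lowest i)) = fscale g (lowest i)" by auto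
  have "(lower ^^ Suc l) ((rai ^^ Suc l) (lowest i)) = (lower ^^ l) (lower ((rai ^^ Suc l) (lowest i)))"
    by (simp add: funpow_swap1)
  also have "\<dots> = fscale (gam i (Suc l)) (fscale g (lowest i))"
    using Suc.prems by (simp only: lower_string[OF i] lin_scale[OF lin_funpow[OF lin_lower]] g)
  finally show ?case using g(1) gam_nonzero[OF i, of "Suc l"] Suc.prems
    by (intro exI[of _ "gam i (Suc l) * g"]) simp
qed

lemma lower_pow_string_zero:
  assumes i: "i < min s t" and l: "l < s + t - 1 - 2 * i" and n: "l < n"
  shows "(lower ^^ n) ((rai ^^ l) (lowest i)) = 0"
proof -
  obtain g where g: "(lower ^^ l) ((rai ^^ l) (lowest i)) = fscale g (lowest i)"
    using lower_pow_string[OF i l] by auto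
  obtain k where "n = k + (1 + l)" using n by (metis Suc_leI add.commute le_iff_add plus_1_eq_Suc)
  then have "(lower ^^ n) ((rai ^^ l) (lowest i)) = (lower ^^ k) (lower ((lower ^^ l) ((rai ^^ l) (lowest i))))"
    by (simp only: funpow_add comp_def) simp
  then show ?thesis
    by (simp add: g lin_scale[OF lin_lower] lower_lowest[OF i] lin_zero[OF lin_funpow[OF lin_lower]])
qed

section \<open>The strings form a basis\<close>

definition strings :: "(nat \<times> nat) set"
  where "strings = (SIGMA i:{..<min s t}. {..<s + t - 1 - 2 * i})"

definition strmap :: "(nat \<times> nat \<Rightarrow>\<^sub>0 'k) \<Rightarrow> (nat \<times> nat \<Rightarrow>\<^sub>0 'k)"
  where "strmap = lext (\<lambda>(i, l). (rai ^^ l) (lowest i))"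

text \<open>For the largest \<open>l\<close> in the support, \<open>Y\<^sup>l\<close> kills the terms \<open>X\<^bsup>l'\<^esup> w\<^sub>i\<close> with \<open>l' < l\<close> and turns those with
  \<open>l' = l\<close> into nonzero multiples of the \<open>w\<^sub>i\<close>, which have different degrees.\<close>

lemma strmap_inj:
  assumes b: "b \<in> fspace strings" and z: "strmap b = 0"
  shows "b = 0"
proof (rule ccontr)
  assume "b \<noteq> 0"
  define l where "l = Max (snd ` Poly_Mapping.keys b)"
  have ne: "snd ` Poly_Mapping.keys b \<noteq> {}" using \<open>b \<noteq> 0\<close> by simp
  have "l \<in> snd ` Poly_Mapping.keys b" unfolding l_def by (rule Max_in) (use ne in auto)
  then obtain i where il: "(i, l) \<in> Poly_Mapping.keys b" by auto
  have keys: "i' < min s t" "l' < s + t - 1 - 2 * i'" "l' \<le> l" if "(i', l') \<in> Poly_Mapping.keys b" for i' l'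
  proof -
    show "l' \<le> l" unfolding l_def using that by (intro Max_ge) force+
  qed (use b that in \<open>auto simp: fspace_def strings_def\<close>)
  obtain g where g: "g \<noteq> 0" "(lower ^^ l) ((rai ^^ l) (lowest i)) = fscale g (lowest i)"
    using lower_pow_string[OF keys(1,2)[OF il]] by auto
  \<comment> \<open>The coefficient at \<open>(0, i)\<close> isolates the term
    \<open>(i, l)\<close>: shorter powers are killed, and \<open>lowest i'\<close> with another
    \<open>i'\<close> does not meet \<open>(0, i)\<close>.\<close>
  have val: "Poly_Mapping.lookup ((lower ^^ l) ((rai ^^ snd k) (lowest (fst k)))) (0, i) = (if k = (i, l) then g else 0)"
    if "k \<in> Poly_Mapping.keys b" for k
  proof (cases k)
    case (Pair i' l')
    note k' = keys[OF that[unfolded Pair]]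
    show ?thesis
    proof (cases "l' = l")
      case True
      obtain g' where g': "(lower ^^ l) ((rai ^^ l) (lowest i')) = fscale g' (lowest i')"
        using lower_pow_string[OF k'(1,2)] True by auto
      show ?thesis
      proof (cases "i' = i")
        case True
        then show ?thesis using \<open>l' = l\<close> Pair by (simp add: g(2) lookup_lowest)
      next
        case False
        then show ?thesis using \<open>l' = l\<close> Pair by (simp add: g' lookup_lowest)
      qed
    next
      case False
      then show ?thesis using lower_pow_string_zero[OF k'(1,2), of l] k'(3) Pair by auto
    qed
  qed
  have "(lower ^^ l) (strmap b) = lext (\<lambda>k. (lower ^^ l) ((rai ^^ snd k) (lowest (fst k)))) b"
    by (rule lin_eqI[where B = UNIV]) (auto simp: strmap_def intro: lin_compose[OF lin_funpow[OF lin_lower]])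
  then have "0 = Poly_Mapping.lookup (lext (\<lambda>k. (lower ^^ l) ((rai ^^ snd k) (lowest (fst k)))) b) (0, i)"
    by (simp add: z lin_zero[OF lin_funpow[OF lin_lower]])
  also have "\<dots> = (\<Sum>k\<in>Poly_Mapping.keys b. if k = (i, l) then Poly_Mapping.lookup b (i, l) * g else 0)"
    unfolding lext_def lookup_sum lookup_fscale by (rule sum.cong) (auto simp: val)
  also have "\<dots> = Poly_Mapping.lookup b (i, l) * g" using il by (simp add: sum.delta)
  finally show False using il g(1) by (simp add: in_keys_iff)
qed

lemma card_strings: "card strings = s * t"
proof -
  \<comment> \<open>At \<open>n = min s t\<close> the closed form is \<open>s * t\<close>, because
    \<open>s + t - min s t\<close> is the maximum.\<close>
  have "n \<le> min s t \<Longrightarrow> (\<Sum>i<n. s + t - 1 - 2 * i) = n * (s + t - n)" for n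
  proof (induction n)
    case (Suc n)
    define k where "k = s + t - 2 * Suc n"
    have "Suc n \<le> s" "Suc n \<le> t" using Suc.prems by simp_all
    then have "s + t = k + 2 * Suc n" unfolding k_def by arith
    then show ?case using Suc by (simp add: algebra_simps)
  qed simp
  from this[of "min s t"] have "(\<Sum>i<min s t. s + t - 1 - 2 * i) = s * t" by (simp add: min_def split: if_splits)
  then show ?thesis by (simp add: strings_def)
qed

text \<open>Equal dimensions turn injectivity into surjectivity.\<close>

lemma strmap_surj: "strmap ` fspace strings = fspace ({..<s} \<times> {..<t})"
proof (rule lin_inj_imp_surj)
  show "strmap p \<in> fspace ({..<s} \<times> {..<t})" if "p \<in> fspace strings" for p
    unfolding strmap_def
  proof (rule lext_fspace[OF that], clarify)
    fix i l assume "(i, l) \<in> strings"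
    then have "(rai ^^ l) (lowest i) \<in> fspace (grid (i + l))"
      by (intro raise_pow_grid lowest_grid) (auto simp: strings_def)
    then show "(rai ^^ l) (lowest i) \<in> fspace ({..<s} \<times> {..<t})"
      by (auto simp: fspace_iff grid_def)
  qed
qed (simp_all add: strmap_inj card_strings card_cartesian_product, simp_all add: strmap_def strings_def)

lemma diag_grid: "u \<in> fspace (grid d) \<Longrightarrow> diag b b' u = fscale (b ^ d * b') u"
  by (rule lin_eqI[OF lin_diag lin_fun_scale[OF lin_id]]) (auto simp: diag_def grid_def)

end

section \<open>The decomposition\<close>

locale ore_decomposition = ore_tensor +
  assumes root: "\<And>n. n \<ge> 1 \<Longrightarrow> \<chi> a ^ n \<noteq> 1"
begin

sublocale lefschetz "\<chi> a" "\<sigma> a" s t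
  using character_simps(2)[OF G.group_axioms chi a G.one_closed] character_simps(2)[OF G.group_axioms sigma a G.one_closed] root
  by unfold_locales auto

abbreviation "m \<equiv> min s t"
text \<open>Summands are numbered from 1 as in the theorem, strings from 0: summand \<open>i\<close>
  is the string of \<open>lowest (i - 1)\<close>.\<close>

abbreviation "len i \<equiv> s + t + 1 - 2 * i"
definition wt :: "nat \<Rightarrow> 'a \<Rightarrow> 'c"
  where "wt i = \<chi> [^]\<^bsub>char_group G\<^esub> (i - 1) \<otimes>\<^bsub>char_group G\<^esub> \<rho> \<otimes>\<^bsub>char_group G\<^esub> \<sigma>"
definition "DS = direct_sum {1..m} (\<lambda>i. V (len i) (wt i))"

definition string :: "nat \<Rightarrow> (nat \<Rightarrow>\<^sub>0 'c) \<Rightarrow> (nat \<times> nat \<Rightarrow>\<^sub>0 'c)"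
  where "string i = lext (\<lambda>l. (X_op ^^ l) (lowest (i - 1)))"

text \<open>A tuple in the direct sum becomes one vector over \<open>strings\<close>, to which the
  bijectivity of \<open>strmap\<close> applies.\<close>

definition pack :: "(nat \<Rightarrow> (nat \<Rightarrow>\<^sub>0 'c)) \<Rightarrow> (nat \<times> nat \<Rightarrow>\<^sub>0 'c)"
  where "pack f = (\<Sum>i\<in>{1..m}. lext (\<lambda>l. bvec (i - 1, l)) (f i))"

lemma wt_char: "wt i \<in> carrier (char_group G)"
proof -
  interpret C: comm_group "char_group G :: ('a \<Rightarrow> 'c) monoid" by (rule comm_group_char_group[OF G.group_axioms])
  show ?thesis unfolding wt_def by (intro C.m_closed C.nat_pow_closed chi rho sigma)
qed

lemma DS_simps:
  "carrier DS = (\<Pi>\<^sub>E i\<in>{1..m}. fspace {..<len i})"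
  "f \<oplus>\<^bsub>DS\<^esub> f' = (\<lambda>i\<in>{1..m}. f i + f' i)"
  "\<zero>\<^bsub>DS\<^esub> = (\<lambda>i\<in>{1..m}. 0)"
  "h \<odot>\<^bsub>DS\<^esub> f = (\<lambda>i\<in>{1..m}. vact \<chi> (len i) (wt i) h (f i))"
  by (auto simp: DS_def direct_sum_def V_module_smult)

lemma lookup_pack: "Poly_Mapping.lookup (pack f) (i, l) = (if i < m then Poly_Mapping.lookup (f (Suc i)) l else 0)"
proof -
  have 1: "Poly_Mapping.lookup (lext (\<lambda>l. bvec (j - 1, l)) (f j)) (i, l) =
      (if j = Suc i then Poly_Mapping.lookup (f (Suc i)) l else 0)" if "j \<in> {1..m}" for j
  proof -
    have "Poly_Mapping.lookup (lext (\<lambda>l. bvec (j - 1, l)) (f j)) (i, l) =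
        (\<Sum>b\<in>Poly_Mapping.keys (f j). if b = l then (if j = Suc i then Poly_Mapping.lookup (f (Suc i)) l else 0) else 0)"
      unfolding lext_def lookup_sum lookup_fscale by (rule sum.cong) (use that in \<open>auto simp: lookup_single when_def\<close>)
    then show ?thesis by (auto simp: sum.delta in_keys_iff)
  qed
  have "Poly_Mapping.lookup (pack f) (i, l) = (\<Sum>j\<in>{1..m}. if j = Suc i then Poly_Mapping.lookup (f (Suc i)) l else 0)"
    unfolding pack_def lookup_sum by (rule sum.cong) (use 1 in auto)
  then show ?thesis by (simp add: sum.delta)
qed

lemma strmap_pack: "strmap (pack f) = (\<Sum>i\<in>{1..m}. string i (f i))"
  unfolding pack_def strmap_def lin_sum[OF lin_lext]
proof (rule sum.cong[OF refl])
  fix i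
  show "lext (\<lambda>(i, l). (X_op ^^ l) (lowest i)) (lext (\<lambda>l. bvec (i - 1, l)) (f i)) = string i (f i)"
    by (rule lin_eqI[where B = UNIV]) (auto simp: string_def intro: lin_compose[OF lin_lext lin_lext])
qed

lemma pack_strings:
  assumes "f \<in> carrier DS"
  shows "pack f \<in> fspace strings"
  unfolding fspace_iff
proof clarify
  fix i l assume il: "(i, l) \<notin> strings"
  show "Poly_Mapping.lookup (pack f) (i, l) = 0"
  proof (cases "i < m")
    case True
    then have "f (Suc i) \<in> fspace {..<len (Suc i)}" using PiE_mem[OF assms[unfolded DS_simps], of "Suc i"] by simp
    moreover have "l \<notin> {..<len (Suc i)}" using il True by (auto simp: strings_def)
    ultimately show ?thesis by (simp add: lookup_pack fspace_iff)
  qed (auto simp: lookup_pack)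
qed

text \<open>On basis vectors g acts by the scalar of the degree; the degree starts at
  \<open>i - 1\<close>, which accounts for the factor \<chi>^(i-1) in \<open>wt i\<close>. Beyond
  \<open>len i\<close> both sides vanish, by \<open>string_end_ge\<close>.\<close>

lemma string_smult:
  assumes i: "i \<in> {1..m}" and h: "h \<in> fspace HB" and v: "v \<in> fspace {..<len i}"
  shows "string i (vact \<chi> (len i) (wt i) h v) = lext (\<lambda>b. G_op (fst b) ((X_op ^^ snd b) (string i v))) h"
proof (rule bilin_eqI[OF _ _ _ _ h v], goal_cases)
  case (5 b l)
  obtain g n where b: "b = (g, n)" "g \<in> carrier G" using 5 by auto
  define j where "j = i - 1"
  have j: "j < m" "i = Suc j" using i by (auto simp: j_def)
  have "G_op g ((X_op ^^ (n + l)) (lowest j)) = fscale (\<chi> g ^ (j + (n + l)) * (\<rho> g * \<sigma> g)) ((X_op ^^ (n + l)) (lowest j))"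
    by (rule diag_grid[OF raise_pow_grid[OF lowest_grid[OF j(1)]]])
  also have "\<chi> g ^ (j + (n + l)) * (\<rho> g * \<sigma> g) = \<chi> g ^ (n + l) * wt i g"
    using b(2) by (simp add: wt_def char_pow_mult[OF G.group_axioms chi] j(2) power_add mult_ac)
  finally have 1: "G_op g ((X_op ^^ (n + l)) (lowest j)) = fscale (\<chi> g ^ (n + l) * wt i g) ((X_op ^^ (n + l)) (lowest j))" .
  have 2: "(X_op ^^ (n + l)) (lowest j) = 0" if "\<not> n + l < len i"
    using that by (intro string_end_ge[OF j(1)]) (simp add: j(2))
  show ?case
    unfolding b(1) vact_single string_def using 1 2
    by (auto simp: j(2) funpow_add lin_zero[OF lin_diag])
qed (auto simp: string_def intro: lin_fun_lext lin_vact lin_compose[OF lin_lext]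
    lin_compose[OF lin_diag lin_compose[OF lin_funpow[OF lin_raise] lin_lext]])

text \<open>Directed from the sum to the tensor product, since the module axioms are known for the
  sum and are transported along this map.\<close>

definition decomp :: "(nat \<Rightarrow> (nat \<Rightarrow>\<^sub>0 'c)) \<Rightarrow> ((nat \<Rightarrow>\<^sub>0 'c) \<times> (nat \<Rightarrow>\<^sub>0 'c) \<Rightarrow>\<^sub>0 'c) set"
  where "decomp f = tensor_class VS VT (lift (strmap (pack f)))"

lemma lin_strmap: "lin strmap"
  by (simp add: strmap_def)

lemma lift_strmap: "f \<in> carrier DS \<Longrightarrow> lift (strmap (pack f)) \<in> FV"
  using strmap_surj pack_strings by (intro lift_fspace) blast

lemma decomp_bij: "bij_betw decomp (carrier DS) (carrier T)"
  unfolding bij_betw_def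
proof
  show "inj_on decomp (carrier DS)"
  proof (rule inj_onI)
    fix f f' assume f: "f \<in> carrier DS" "f' \<in> carrier DS" "decomp f = decomp f'"
    from f(3) have "strmap (pack f) = strmap (pack f')"
      unfolding decomp_def tensor_class_eq_iff_coord[OF k lift_strmap[OF f(1)] lift_strmap[OF f(2)]]
      by (simp only: coord_lift)
    then have "strmap (pack f - pack f') = 0"
      by (simp add: lin_diff[OF lin_strmap])
    then have "pack f - pack f' = 0"
      by (rule strmap_inj[OF fspace_diff[OF pack_strings[OF f(1)] pack_strings[OF f(2)]]])
    then have eq: "Poly_Mapping.lookup (pack f) il = Poly_Mapping.lookup (pack f') il" for il by simp
    show "f = f'"
    proof (rule PiE_ext[OF f(1,2)[unfolded DS_simps]])
      fix i assume i: "i \<in> {1..m}"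
      then obtain j where j: "i = Suc j" "j < m" by (cases i) auto
      show "f i = f' i"
      proof (rule poly_mapping_eqI)
        show "Poly_Mapping.lookup (f i) l = Poly_Mapping.lookup (f' i) l" for l
          using eq[of "(j, l)"] j by (simp add: lookup_pack)
      qed
    qed
  qed
  show "decomp ` carrier DS = carrier T"
  proof (intro equalityI subsetI)
    fix P assume "P \<in> decomp ` carrier DS"
    then show "P \<in> carrier T" by (auto simp: decomp_def T_carrier intro: lift_strmap)
  next
    fix P assume "P \<in> carrier T"
    then obtain p where p: "p \<in> FV" "P = tensor_class VS VT p" by (auto simp: T_carrier)
    have "coord p \<in> strmap ` fspace strings"
      unfolding strmap_surj by (rule coord_fspace[OF p(1)])
    then obtain b where b: "b \<in> fspace strings" "coord p = strmap b" by blast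
    \<comment> \<open>The inverse of \<open>pack\<close>: component \<open>i\<close> collects the
      coefficients of \<open>b\<close> on the string \<open>i - 1\<close>.\<close>
    define f where "f = (\<lambda>i\<in>{1..m}. \<Sum>l<len i. Poly_Mapping.single l (Poly_Mapping.lookup b (i - 1, l)))"
    have f: "f \<in> carrier DS"
      unfolding DS_simps f_def by (auto intro!: fspace_sum)
    have "pack f = b"
    proof (rule poly_mapping_eqI, clarify)
      fix i l
      show "Poly_Mapping.lookup (pack f) (i, l) = Poly_Mapping.lookup b (i, l)"
        using b(1) by (auto simp: lookup_pack f_def lookup_sum lookup_single when_def fspace_iff strings_def)
    qed
    then have "decomp f = P"
      unfolding decomp_def p(2) tensor_class_eq_iff_coord[OF k lift_strmap[OF f] p(1)]
      by (simp add: coord_lift b(2))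
    then show "P \<in> decomp ` carrier DS" using f by blast
  qed
qed

lemma tensor_decomposition: "left_module_isomorphic H T DS"
proof (rule left_module_isomorphicI[OF _ decomp_bij])
  show "left_module H DS"
    unfolding DS_def by (intro left_module_direct_sum ring_H left_module_V wt_char) auto
next
  fix f f' assume f: "f \<in> carrier DS" "f' \<in> carrier DS"
  have "strmap (pack (f \<oplus>\<^bsub>DS\<^esub> f')) = strmap (pack f) + strmap (pack f')"
    unfolding strmap_pack by (simp add: DS_simps string_def lext_add flip: sum.distrib)
  then show "decomp (f \<oplus>\<^bsub>DS\<^esub> f') = decomp f \<oplus>\<^bsub>T\<^esub> decomp f'"
    by (simp add: decomp_def T_add lin_add[OF lin_lift])
next
  have "strmap (pack \<zero>\<^bsub>DS\<^esub>) = 0"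
    unfolding strmap_pack by (simp add: DS_simps string_def)
  then show "decomp \<zero>\<^bsub>DS\<^esub> = \<zero>\<^bsub>T\<^esub>"
    by (simp add: decomp_def T_zero lin_zero[OF lin_lift])
next
  fix h f assume h: "h \<in> carrier H" and f: "f \<in> carrier DS"
  then have hB: "h \<in> fspace HB" by simp
  have hf: "h \<odot>\<^bsub>DS\<^esub> f \<in> carrier DS"
    unfolding DS_simps by (auto intro: vact_fspace)
  \<comment> \<open>In coordinates \<open>h\<close> acts by a linear map, which therefore commutes
    with the sum over the strings.\<close>
  have lin: "lin (\<lambda>u. lext (\<lambda>b. G_op (fst b) ((X_op ^^ snd b) u)) h)"
    by (intro lin_fun_lext lin_compose[OF lin_diag] lin_funpow lin_raise)
  have d: "lext dbasis h \<in> fspace2 HB HB" by (rule lext_fspace[OF hB dbasis_fspace])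
  have "strmap (pack (h \<odot>\<^bsub>DS\<^esub> f)) = (\<Sum>i\<in>{1..m}. lext (\<lambda>b. G_op (fst b) ((X_op ^^ snd b) (string i (f i)))) h)"
    unfolding strmap_pack
    by (rule sum.cong) (use f hB in \<open>auto simp: DS_simps string_smult[simplified] PiE_iff\<close>)
  also have "\<dots> = lext (\<lambda>b. G_op (fst b) ((X_op ^^ snd b) (strmap (pack f)))) h"
    unfolding strmap_pack by (rule lin_sum[OF lin, symmetric])
  also have "\<dots> = coord (tact (lext dbasis h) (lift (strmap (pack f))))"
    using coord_tact[OF hB lift_strmap[OF f]] by (simp add: coord_lift)
  finally show "decomp (h \<odot>\<^bsub>DS\<^esub> f) = h \<odot>\<^bsub>T\<^esub> decomp f"
    unfolding decomp_def T_smult[OF hB lift_strmap[OF f]]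
      tensor_class_eq_iff_coord[OF k lift_strmap[OF hf] tact_fspace[OF d lift_strmap[OF f]]]
    by (simp only: coord_lift)
qed

end

theorem theorem3p3:
  fixes G :: "('g, 'm) monoid_scheme"
    and a :: 'g
    and \<chi> \<rho> \<sigma> :: "'g \<Rightarrow> 'k::{alg_closed_field, field_char_0}"
    and s t :: nat
  defines "Ghat \<equiv> char_group G"
  defines "H \<equiv> hopf_ore G (inv\<^bsub>Ghat\<^esub> \<chi>) a"
  defines "q \<equiv> (inv\<^bsub>Ghat\<^esub> \<chi>) a"
  assumes "group G"
    and "a \<in> center G"
    and "\<chi> \<in> carrier Ghat"
    and "\<chi> a \<noteq> 1"
    and "group.ord Ghat \<chi> = 0" \<comment> \<open>order 0 encodes infinite order\<close>
    and "\<forall>n\<ge>1. q ^ n \<noteq> 1"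
    and "\<rho> \<in> carrier Ghat" and "\<sigma> \<in> carrier Ghat"
    and "s \<ge> 1" and "t \<ge> 1"
  shows "left_module_isomorphic H
    (tensor_module H (V_module \<chi> s \<rho>) (V_module \<chi> t \<sigma>))
    (direct_sum {1..min s t}
      (\<lambda>i. V_module \<chi> (s + t + 1 - 2 * i) (\<chi> [^]\<^bsub>Ghat\<^esub> (i - 1) \<otimes>\<^bsub>Ghat\<^esub> \<rho> \<otimes>\<^bsub>Ghat\<^esub> \<sigma>)))"
proof -
  interpret G: group G by fact
  interpret C: comm_group "char_group G :: ('g \<Rightarrow> 'k) monoid" by (rule comm_group_char_group[OF \<open>group G\<close>])
  have chi: "\<chi> \<in> carrier (char_group G)" using assms by simp
  have a: "a \<in> carrier G" using \<open>a \<in> center G\<close> by (simp add: center_def)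
  have inv: "(inv\<^bsub>char_group G\<^esub> \<chi>) g = inverse (\<chi> g)" "\<chi> g \<noteq> 0" if "g \<in> carrier G" for g
    using inv_char[OF \<open>group G\<close> chi that] character_simps(2)[OF \<open>group G\<close> chi that that] by auto
  interpret ore_decomposition G \<chi> "inv\<^bsub>char_group G\<^esub> \<chi>" a \<rho> \<sigma> s t
  proof unfold_locales
    \<comment> \<open>\<chi>(a) is the inverse of \<open>q\<close>, so it is not a root of unity
      either.\<close>
    show "\<chi> a ^ n \<noteq> 1" if "n \<ge> 1" for n
      using assms(9) that inv(1)[OF a] by (auto simp: q_def Ghat_def power_inverse)
  qed (use assms chi a inv in \<open>auto simp: Ghat_def\<close>)
  show ?thesis unfolding H_def Ghat_def by (rule tensor_decomposition[unfolded DS_def wt_def])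
qed

end
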